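(* Let $n\geq 2$ and let $x\in 2^\omega$ satisfy $\dim(x)=s=\frac1n$. Then for every integer $k<\lfloor 1/s\rfloor-1$ there is no computable $p\in[0,\tfrac12]$ such that the family of $\mu^*_p$-random closed sets has degree of intersectability $k$ and $x$ belongs to some $\mu^*_p$-random closed set.
   Context: $\mathcal{K}(2^\omega)$ is the set of non-empty closed subsets of $2^\omega$. For $x\in 3^\omega$ the tree $T_x\subseteq 2^{<\omega}$ is defined inductively: $\epsilon\in T_x$; if $\sigma$ is the $(i+1)$-st node placed in $T_x$ (in length-lexicographic order), then only $\sigma0$ is added if $x(i)=0$, only $\sigma1$ if $x(i)=1$, both if $x(i)=2$. Each $C\in\mathcal{K}(2^\omega)$ has a unique code $x_C$ with $[T_{x_C}]=C$. $\mu_p$ ($p\in[0,\tfrac12]$) is the Bernoulli measure on $3^\omega$ with symbol probabilities $p,p,1-2p$ for $0,1,2$; a closed set $C$ is $\mu^*_p$-random if $x_C$ is $\mu_p$-Martin-L\"of random. Closed sets $P_1,\dots,P_n$ are mutually $\mu^*_p$-random if each $x_{P_i}$ is $\mu_p$-random relative to the join (interleaving) $\bigoplus_{j\neq i}x_{P_j}$. The degree of intersectability of the family of $\mu_p^*$-random closed sets is the unique $n\geq1$ such that some $n$ mutually $\mu_p^*$-random closed sets have non-empty intersection, while any $n+1$ mutually $\mu_p^*$-random closed sets have empty intersection. $\dim(x)=\liminf_{r\to\infty}C(x\restriction r)/r$, where $C$ is Kolmogorov complexity. *)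

theory Defs
  imports "HOL-Probability.Probability" "HOL-Library.Nat_Bijection"
begin

section \<open>Oracle computability\<close>

text \<open>
  Kleene's partial recursive functions of several arguments, relative to a given function
  \<^term>\<open>A :: nat \<Rightarrow> nat\<close>.  Absolute computability is computability relative to the constant
  zero function.
\<close>

datatype recf =
  Zero | Succ | Proj nat | Query | Comp recf "recf list" | PrimRec recf recf | Minim recf

inductive computes :: "(nat \<Rightarrow> nat) \<Rightarrow> recf \<Rightarrow> nat list \<Rightarrow> nat \<Rightarrow> bool"
  for A :: "nat \<Rightarrow> nat" where
  zero: "computes A Zero xs 0"
| succ: "computes A Succ [x] (Suc x)"
| proj: "i < length xs \<Longrightarrow> computes A (Proj i) xs (xs ! i)"
| query: "computes A Query [x] (A x)"
| comp: "list_all2 (\<lambda>g y. computes A g xs y) gs ys \<Longrightarrow> computes A f ys z \<Longrightarrow>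
    computes A (Comp f gs) xs z"
| primrec_0: "computes A f xs y \<Longrightarrow> computes A (PrimRec f g) (0 # xs) y"
| primrec_Suc: "computes A (PrimRec f g) (m # xs) r \<Longrightarrow> computes A g (m # r # xs) y \<Longrightarrow>
    computes A (PrimRec f g) (Suc m # xs) y"
| minim: "computes A f (m # xs) 0 \<Longrightarrow> (\<And>k. k < m \<Longrightarrow> \<exists>y. computes A f (k # xs) (Suc y)) \<Longrightarrow>
    computes A (Minim f) xs m"

definition no_oracle :: "nat \<Rightarrow> nat" where
  "no_oracle = (\<lambda>_. 0)"

definition total_computable :: "(nat \<Rightarrow> nat) \<Rightarrow> bool" where
  "total_computable f \<longleftrightarrow> (\<exists>e. \<forall>n. computes no_oracle e [n] (f n))"

text \<open>
  A real is computable if some computable sequence of rationals, here given as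
  $(f(n)-g(n))/(h(n)+1)$ with computable $f,g,h$, converges to it with error at most $2^{-n}$.
\<close>

definition computable_real :: "real \<Rightarrow> bool" where
  "computable_real r \<longleftrightarrow>
    (\<exists>f g h. total_computable f \<and> total_computable g \<and> total_computable h \<and>
      (\<forall>n. \<bar>r - (real (f n) - real (g n)) / real (h n + 1)\<bar> \<le> (1/2) ^ n))"

text \<open>
  A sequence of sets of finite words over the natural numbers is uniformly c.e.\ in \<^term>\<open>A\<close>
  if \<open>{(m, \<sigma>). \<sigma> \<in> W m}\<close> is the domain of a partial function that is recursive in \<^term>\<open>A\<close>.
\<close>

definition uniformly_ce :: "(nat \<Rightarrow> nat) \<Rightarrow> (nat \<Rightarrow> nat list set) \<Rightarrow> bool" where
  "uniformly_ce A W \<longleftrightarrow> (\<exists>e. \<forall>m \<sigma>. \<sigma> \<in> W m \<longleftrightarrow> (\<exists>y. computes A e [m, list_encode \<sigma>] y))"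


section \<open>Kolmogorov complexity and dimension\<close>

definition bits_encode :: "bool list \<Rightarrow> nat" where
  "bits_encode \<sigma> = list_encode (map of_bool \<sigma>)"

definition partial_computable_machine :: "(bool list \<Rightarrow> bool list option) \<Rightarrow> bool" where
  "partial_computable_machine M \<longleftrightarrow>
    (\<exists>e. \<forall>\<sigma> y. computes no_oracle e [bits_encode \<sigma>] y \<longleftrightarrow>
      (\<exists>\<tau>. M \<sigma> = Some \<tau> \<and> y = bits_encode \<tau>))"

text \<open>
  An additively optimal machine: every other machine is simulated with a constant overhead in
  program length.  Plain complexity is defined with respect to such a reference machine and
  depends on its choice only up to an additive constant.
\<close>

definition optimal_machine :: "(bool list \<Rightarrow> bool list option) \<Rightarrow> bool" where
  "optimal_machine U \<longleftrightarrow> partial_computable_machine U \<and>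
    (\<forall>M. partial_computable_machine M \<longrightarrow>
      (\<exists>c. \<forall>\<pi> \<sigma>. M \<pi> = Some \<sigma> \<longrightarrow> (\<exists>\<rho>. U \<rho> = Some \<sigma> \<and> length \<rho> \<le> length \<pi> + c)))"

definition complexity :: "(bool list \<Rightarrow> bool list option) \<Rightarrow> bool list \<Rightarrow> nat" where
  "complexity U \<sigma> = (LEAST l. \<exists>\<rho>. length \<rho> = l \<and> U \<rho> = Some \<sigma>)"

definition initial :: "(nat \<Rightarrow> 'a) \<Rightarrow> nat \<Rightarrow> 'a list" where
  "initial x r = map x [0..<r]"

definition effective_dim :: "(bool list \<Rightarrow> bool list option) \<Rightarrow> (nat \<Rightarrow> bool) \<Rightarrow> ereal" where
  "effective_dim U x = liminf (\<lambda>r. ereal (real (complexity U (initial x r)) / real r))"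


section \<open>Bernoulli measures and Martin-Loef randomness on ternary sequences\<close>

text \<open>
  Ternary sequences are the functions \<^typ>\<open>nat \<Rightarrow> nat\<close> with values below 3, so that they can serve
  directly as oracles.  The measure lives on all of \<^typ>\<open>nat \<Rightarrow> nat\<close> but is concentrated on
  these sequences.
\<close>

definition ternary :: "(nat \<Rightarrow> nat) \<Rightarrow> bool" where
  "ternary x \<longleftrightarrow> (\<forall>i. x i < 3)"

definition bernoulli3 :: "real \<Rightarrow> (nat \<Rightarrow> nat) measure" where
  "bernoulli3 p = (\<Pi>\<^sub>M i\<in>UNIV. measure_pmf (pmf_of_list [(0, p), (1, p), (2, 1 - 2 * p)]))"

definition cylinders :: "nat list set \<Rightarrow> (nat \<Rightarrow> nat) set" where
  "cylinders W = {x. \<exists>r. initial x r \<in> W}"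

definition martin_loef_test :: "real \<Rightarrow> (nat \<Rightarrow> nat) \<Rightarrow> (nat \<Rightarrow> nat list set) \<Rightarrow> bool" where
  "martin_loef_test p A W \<longleftrightarrow> uniformly_ce A W \<and>
    (\<forall>m. measure (bernoulli3 p) (cylinders (W m)) \<le> (1/2) ^ m)"

definition martin_loef_random :: "real \<Rightarrow> (nat \<Rightarrow> nat) \<Rightarrow> (nat \<Rightarrow> nat) \<Rightarrow> bool" where
  "martin_loef_random p A x \<longleftrightarrow> ternary x \<and> (\<forall>W. martin_loef_test p A W \<longrightarrow> x \<notin> (\<Inter>m. cylinders (W m)))"


section \<open>Coding closed sets by ternary sequences\<close>

definition successors :: "nat \<Rightarrow> bool list \<Rightarrow> bool list list" where
  "successors a \<sigma> =
    (if a = 0 then [\<sigma> @ [False]] else if a = 1 then [\<sigma> @ [True]]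
     else [\<sigma> @ [False], \<sigma> @ [True]])"

text \<open>
  \<open>nodes x i\<close> lists the nodes present after the first \<open>i\<close> of them have been given their
  successors.  Appending the successors at the end keeps the list in length-lexicographic order,
  and it always has more than \<open>i\<close> entries.
\<close>

primrec nodes :: "(nat \<Rightarrow> nat) \<Rightarrow> nat \<Rightarrow> bool list list" where
  "nodes x 0 = [[]]"
| "nodes x (Suc i) = nodes x i @ successors (x i) (nodes x i ! i)"

definition tree :: "(nat \<Rightarrow> nat) \<Rightarrow> bool list set" where
  "tree x = (\<Union>i. set (nodes x i))"

definition paths :: "bool list set \<Rightarrow> (nat \<Rightarrow> bool) set" where
  "paths T = {z. \<forall>r. initial z r \<in> T}"

definition closed_sets :: "(nat \<Rightarrow> bool) set set" where
  "closed_sets = {C. closed C \<and> C \<noteq> {}}"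

definition code_of :: "(nat \<Rightarrow> bool) set \<Rightarrow> nat \<Rightarrow> nat" where
  "code_of C = (THE x. ternary x \<and> paths (tree x) = C)"


section \<open>Random closed sets and their intersections\<close>

definition random_closed :: "real \<Rightarrow> (nat \<Rightarrow> bool) set \<Rightarrow> bool" where
  "random_closed p C \<longleftrightarrow> C \<in> closed_sets \<and> martin_loef_random p no_oracle (code_of C)"

text \<open>The join of no sequences at all is the constant zero function.\<close>

definition join :: "(nat \<Rightarrow> nat) list \<Rightarrow> nat \<Rightarrow> nat" where
  "join ys = (if ys = [] then no_oracle
     else (\<lambda>i. (ys ! (i mod length ys)) (i div length ys)))"

definition mutually_random_closed :: "real \<Rightarrow> (nat \<Rightarrow> bool) set list \<Rightarrow> bool" where
  "mutually_random_closed p Ps \<longleftrightarrow> set Ps \<subseteq> closed_sets \<and>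
    (\<forall>i<length Ps. martin_loef_random p
      (join (map code_of (take i Ps @ drop (Suc i) Ps))) (code_of (Ps ! i)))"

text \<open>
  At most one \<open>n\<close> satisfies this condition, as subfamilies of mutually random families are
  mutually random.  Families may have repetitions, which matters for \<open>p = 0\<close>: the only
  \<open>\<mu>\<^sup>*\<^sub>0\<close>-random closed set is the whole space, and there is no degree of intersectability.
\<close>

definition degree_of_intersectability :: "real \<Rightarrow> nat \<Rightarrow> bool" where
  "degree_of_intersectability p n \<longleftrightarrow> n \<ge> 1 \<and>
    (\<exists>Ps. length Ps = n \<and> mutually_random_closed p Ps \<and> \<Inter> (set Ps) \<noteq> {}) \<and>
    (\<forall>Ps. length Ps = n + 1 \<and> mutually_random_closed p Ps \<longrightarrow> \<Inter> (set Ps) = {})"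


section \<open>Existence and uniqueness of codes\<close>

lemma initial_0 [simp]: "initial x 0 = []"
  by (simp add: initial_def)

lemma initial_Suc: "initial x (Suc r) = initial x r @ [x r]"
  by (simp add: initial_def)

lemma length_nodes: "i < length (nodes x i)"
proof (induction i)
  case (Suc i)
  have "length (successors (x i) (nodes x i ! i)) \<ge> 1"
    by (simp add: successors_def)
  with Suc show ?case by simp
qed simp

lemma nodes_mono: "i \<le> j \<Longrightarrow> \<exists>zs. nodes x j = nodes x i @ zs"
  by (induction j rule: dec_induct) auto

lemma nodes_nth: "k < length (nodes x i) \<Longrightarrow> nodes x i ! k = nodes x k ! k"
proof -
  assume k: "k < length (nodes x i)"
  show ?thesis
  proof (cases "i \<le> k")
    case True
    then show ?thesis using nodes_mono[of i k x] k by (auto simp: nth_append)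
  next
    case False
    then show ?thesis using nodes_mono[of k i x] length_nodes[of k x] by (auto simp: nth_append)
  qed
qed

lemma in_nodes_iff:
  "\<tau> \<in> set (nodes x i) \<longleftrightarrow> \<tau> = [] \<or> (\<exists>k<i. \<tau> \<in> set (successors (x k) (nodes x k ! k)))"
  by (induction i) (auto simp: less_Suc_eq)

lemma in_successors: "\<tau> \<in> set (successors a \<sigma>) \<Longrightarrow> \<tau> \<noteq> [] \<and> butlast \<tau> = \<sigma>"
  by (auto simp: successors_def split: if_splits)

lemma distinct_nodes: "distinct (nodes x i)"
proof (induction i)
  case (Suc i)
  have "\<tau> \<notin> set (nodes x i)" if \<tau>: "\<tau> \<in> set (successors (x i) (nodes x i ! i))" for \<tau>
  proof
    assume "\<tau> \<in> set (nodes x i)"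
    with in_successors[OF \<tau>] obtain k where k: "k < i" "\<tau> \<in> set (successors (x k) (nodes x k ! k))"
      by (auto simp: in_nodes_iff)
    then have "nodes x k ! k = nodes x i ! i"
      using in_successors \<tau> by metis
    then have "nodes x i ! k = nodes x i ! i"
      using nodes_nth[of k x i] length_nodes[of i x] k(1) by simp
    then show False
      using Suc k(1) length_nodes[of i x] by (auto simp: nth_eq_iff_index_eq)
  qed
  moreover have "distinct (successors (x i) (nodes x i ! i))"
    by (simp add: successors_def)
  ultimately show ?case using Suc by auto
qed simp

lemma node_inj: "nodes x k ! k = nodes x i ! i \<Longrightarrow> k = i"
proof (induction k i rule: linorder_wlog)
  case (le a b)
  then have "nodes x b ! a = nodes x b ! b"
    using nodes_nth[of a x b] length_nodes[of b x] by simp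
  then show ?case
    using distinct_nodes[of x b] le length_nodes[of b x] by (auto simp: nth_eq_iff_index_eq)
qed simp

lemma tree_iff:
  "\<tau> \<in> tree x \<longleftrightarrow> \<tau> = [] \<or> (\<exists>k. \<tau> \<in> set (successors (x k) (nodes x k ! k)))"
  unfolding tree_def by (auto simp: in_nodes_iff)

lemma tree_node: "\<sigma> \<in> tree x \<longleftrightarrow> (\<exists>k. \<sigma> = nodes x k ! k)"
proof
  assume "\<sigma> \<in> tree x"
  then obtain i k where "k < length (nodes x i)" "nodes x i ! k = \<sigma>"
    by (auto simp: tree_def in_set_conv_nth)
  then show "\<exists>k. \<sigma> = nodes x k ! k" using nodes_nth by metis
next
  assume "\<exists>k. \<sigma> = nodes x k ! k"
  then obtain k where "\<sigma> = nodes x k ! k" by blast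
  then have "\<sigma> \<in> set (nodes x k)" using nth_mem[OF length_nodes[of k x]] by simp
  then show "\<sigma> \<in> tree x" by (auto simp: tree_def)
qed

lemma tree_child:
  "nodes x k ! k @ [b] \<in> tree x \<longleftrightarrow> nodes x k ! k @ [b] \<in> set (successors (x k) (nodes x k ! k))"
proof
  assume "nodes x k ! k @ [b] \<in> tree x"
  then obtain j where j: "nodes x k ! k @ [b] \<in> set (successors (x j) (nodes x j ! j))"
    by (auto simp: tree_iff)
  then have "nodes x j ! j = nodes x k ! k"
    using in_successors[OF j] by simp
  then have "j = k" by (rule node_inj)
  with j show "nodes x k ! k @ [b] \<in> set (successors (x k) (nodes x k ! k))" by simp
qed (auto simp: tree_iff)

lemma tree_prefix: "\<sigma> @ [b] \<in> tree x \<Longrightarrow> \<sigma> \<in> tree x"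
proof -
  assume "\<sigma> @ [b] \<in> tree x"
  then obtain k where k: "\<sigma> @ [b] \<in> set (successors (x k) (nodes x k ! k))"
    by (auto simp: tree_iff)
  have "\<sigma> = nodes x k ! k" using in_successors[OF k] by simp
  then show ?thesis by (auto simp: tree_node)
qed

lemma tree_extend: "\<sigma> \<in> tree x \<Longrightarrow> \<exists>b. \<sigma> @ [b] \<in> tree x"
proof -
  assume "\<sigma> \<in> tree x"
  then obtain k where k: "\<sigma> = nodes x k ! k" by (auto simp: tree_node)
  show ?thesis unfolding k tree_child by (auto simp: successors_def)
qed

lemma tree_eq_prefixes: "tree x = {initial z r | z r. z \<in> paths (tree x)}"
proof
  show "tree x \<subseteq> {initial z r | z r. z \<in> paths (tree x)}"
  proof
    fix \<sigma> assume \<sigma>: "\<sigma> \<in> tree x"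
    define ext where "ext = rec_nat \<sigma> (\<lambda>_ \<tau>. \<tau> @ [SOME b. \<tau> @ [b] \<in> tree x])"
    have ext_0: "ext 0 = \<sigma>" and
      ext_Suc: "\<And>i. ext (Suc i) = ext i @ [SOME b. ext i @ [b] \<in> tree x]"
      by (simp_all add: ext_def)
    have ext_tree: "ext i \<in> tree x" for i
    proof (induction i)
      case (Suc i)
      then show ?case using someI_ex[OF tree_extend[OF Suc]] ext_Suc by simp
    qed (simp add: ext_0 \<sigma>)
    have ext_length: "length (ext i) = length \<sigma> + i" for i
      by (induction i) (simp_all add: ext_0 ext_Suc)
    have ext_mono: "\<exists>zs. ext j = ext i @ zs" if "i \<le> j" for i j
      using that by (induction j rule: dec_induct) (auto simp: ext_Suc)
    define z where "z r = ext (Suc r) ! r" for r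
    have z: "ext i ! r = z r" if "r < length \<sigma> + i" for i r
    proof (cases "i \<le> Suc r")
      case True
      then show ?thesis using ext_mono[OF True] that ext_length
        by (auto simp: z_def nth_append)
    next
      case False
      then have "Suc r \<le> i" by simp
      then show ?thesis using ext_mono[of "Suc r" i] ext_length[of "Suc r"]
        by (auto simp: z_def nth_append)
    qed
    have res: "initial z (length \<sigma> + i) = ext i" for i
      by (rule nth_equalityI) (simp_all add: initial_def ext_length z del: upt_Suc)
    have "initial z r \<in> tree x" for r
    proof -
      have "initial z (length \<sigma> + r) \<in> tree x" using res ext_tree by simp
      moreover have "initial z (r + j) \<in> tree x \<Longrightarrow> initial z r \<in> tree x" for j
        by (induction j) (auto simp: initial_Suc dest: tree_prefix)
      ultimately show ?thesis by (simp add: add.commute)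
    qed
    then have "z \<in> paths (tree x)" by (simp add: paths_def)
    moreover have "\<sigma> = initial z (length \<sigma>)" using res[of 0] ext_0 by simp
    ultimately show "\<sigma> \<in> {initial z r | z r. z \<in> paths (tree x)}" by blast
  qed
qed (auto simp: paths_def)

lemma successors_inj:
  assumes "\<And>b. \<sigma> @ [b] \<in> set (successors a \<sigma>) \<longleftrightarrow> \<sigma> @ [b] \<in> set (successors a' \<sigma>)"
    and "a < 3" "a' < 3"
  shows "a = a'"
  using assms(1)[of True] assms(1)[of False] assms(2,3)
  by (auto simp: successors_def split: if_splits)

lemma code_unique:
  assumes "ternary x" "ternary y" "paths (tree x) = paths (tree y)"
  shows "x = y"
proof -
  have tree: "tree x = tree y"
    using assms(3) tree_eq_prefixes[of x] tree_eq_prefixes[of y] by simp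
  have step: "x i = y i" if "nodes x i = nodes y i" for i
    using that assms(1,2) tree_child[of x i] tree_child[of y i]
    by (intro successors_inj[of "nodes x i ! i"]) (simp_all add: tree ternary_def)
  have "nodes x i = nodes y i" for i
  proof (induction i)
    case (Suc i)
    then show ?case using step[OF Suc] by simp
  qed simp
  with step show ?thesis by auto
qed

lemma closed_limit:
  fixes z :: "nat \<Rightarrow> bool"
  assumes "closed C" and "\<And>r. \<exists>w\<in>C. initial w r = initial z r"
  shows "z \<in> C"
proof -
  obtain w where w: "\<And>r. w r \<in> C" "\<And>r. initial (w r) r = initial z r"
    using assms(2) by metis
  have agree: "w r i = z i" if "i < r" for r i
    using arg_cong[OF w(2)[of r], of "\<lambda>l. l ! i"] that by (simp add: initial_def)
  have "(\<lambda>r. w r i) \<longlonglongrightarrow> z i" for i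
    by (rule tendsto_eventually) (use agree in \<open>auto intro: eventually_sequentiallyI[of "Suc i"]\<close>)
  then have "limitin euclidean w z sequentially"
    by (simp add: limitin_componentwise flip: euclidean_product_topology)
  then have "w \<longlonglongrightarrow> z" by simp
  then show ?thesis
    using closed_sequentially[OF assms(1), of w z] w(1) by blast
qed

lemma code_exists:
  assumes "closed C" "C \<noteq> {}"
  shows "\<exists>x. ternary x \<and> paths (tree x) = C"
proof -
  define T where "T = {initial z r | z r. z \<in> C}"
  define dig :: "bool list \<Rightarrow> nat" where
    "dig \<sigma> = (if \<sigma> @ [True] \<notin> T then 0 else if \<sigma> @ [False] \<notin> T then 1 else 2)" for \<sigma>
  define N where "N = rec_nat [[]] (\<lambda>i l. l @ successors (dig (l ! i)) (l ! i))"
  have N: "N 0 = [[]]" "\<And>i. N (Suc i) = N i @ successors (dig (N i ! i)) (N i ! i)"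
    by (simp_all add: N_def)
  define x where "x i = dig (N i ! i)" for i
  have nodes: "nodes x i = N i" for i
    by (induction i) (simp_all add: N x_def)
  have x: "x i = dig (nodes x i ! i)" for i
    by (simp add: nodes) (simp add: x_def)
  have T_ext: "\<exists>b. \<sigma> @ [b] \<in> T" if \<sigma>: "\<sigma> \<in> T" for \<sigma>
  proof -
    obtain z r where "z \<in> C" "\<sigma> = initial z r" using \<sigma> by (auto simp: T_def)
    then have "z \<in> C \<and> \<sigma> @ [z r] = initial z (Suc r)" by (simp add: initial_Suc)
    then have "\<sigma> @ [z r] \<in> T" unfolding T_def by blast
    then show ?thesis ..
  qed
  have T_prefix: "\<sigma> \<in> T" if \<sigma>: "\<sigma> @ [b] \<in> T" for \<sigma> b
  proof -
    obtain z r where z: "z \<in> C" "\<sigma> @ [b] = initial z r" using \<sigma> by (auto simp: T_def)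
    then obtain r' where "r = Suc r'" by (cases r) auto
    with z have "\<sigma> = initial z r'" by (simp add: initial_Suc)
    with z show ?thesis by (auto simp: T_def)
  qed
  have child: "\<sigma> @ [b] \<in> set (successors (dig \<sigma>) \<sigma>) \<longleftrightarrow> \<sigma> @ [b] \<in> T" if "\<sigma> \<in> T" for \<sigma> b
    using T_ext[OF that] by (cases b) (auto simp: successors_def dig_def, (metis (full_types))+)
  obtain z where "z \<in> C" using assms(2) by blast
  then have "z \<in> C \<and> [] = initial z 0" by simp
  then have empty: "[] \<in> T" unfolding T_def by blast
  have "\<sigma> \<in> tree x \<longleftrightarrow> \<sigma> \<in> T" for \<sigma>
  proof (induction \<sigma> rule: rev_induct)
    case Nil
    then show ?case by (simp add: empty tree_iff)
  next
    case (snoc b \<sigma>)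
    show ?case
    proof (cases "\<sigma> \<in> tree x")
      case True
      then obtain k where "\<sigma> = nodes x k ! k" by (auto simp: tree_node)
      then have "\<sigma> @ [b] \<in> tree x \<longleftrightarrow> \<sigma> @ [b] \<in> set (successors (dig \<sigma>) \<sigma>)"
        using tree_child[of x k b] x[of k] by simp
      then show ?thesis using child True snoc by simp
    next
      case False
      then show ?thesis using snoc tree_prefix T_prefix by blast
    qed
  qed
  then have "tree x = T" by blast
  moreover have "paths T = C"
  proof
    show "paths T \<subseteq> C"
    proof
      fix z assume z: "z \<in> paths T"
      have "\<exists>w\<in>C. initial w r = initial z r" for r
      proof -
        have "initial z r \<in> T" using z by (simp add: paths_def)
        then obtain w r' where w: "w \<in> C" "initial z r = initial w r'" by (auto simp: T_def)
        moreover have "r' = r" using arg_cong[OF w(2), of length] by (simp add: initial_def)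
        ultimately show ?thesis by metis
      qed
      then show "z \<in> C" by (rule closed_limit[OF assms(1)])
    qed
  qed (auto simp: paths_def T_def)
  moreover have "ternary x" by (simp add: ternary_def x_def dig_def)
  ultimately show ?thesis by blast
qed

lemma code_works:
  assumes "C \<in> closed_sets"
  shows "ternary (code_of C)" "paths (tree (code_of C)) = C"
proof -
  have "\<exists>!x. ternary x \<and> paths (tree x) = C"
    using code_exists[of C] code_unique assms by (auto simp: closed_sets_def)
  from theI'[OF this] show "ternary (code_of C)" "paths (tree (code_of C)) = C"
    by (simp_all add: code_of_def)
qed

end

theory Submission
  imports Defs
begin

text \<open>Put \<open>q = 1 - p\<close>.  A fixed word of length \<open>r\<close> lies in the random tree with probability
  \<open>q ^ r\<close>.  If \<open>x\<close> has dimension \<open>1 / n\<close>, then for any \<open>t > 1 / n\<close> infinitely many initial segments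
  of \<open>x\<close> have complexity below \<open>t r\<close>.  There are about \<open>2 ^ (t r)\<close> such words of length \<open>r\<close>, and they
  form a Martin-Loef test as soon as \<open>2 powr t * q < 1\<close>.  So membership of \<open>x\<close> in a random closed set
  forces \<open>q ^ n \<ge> 1 / 2\<close>, whence \<open>2 q ^ (d + 1) > 1\<close> if \<open>d + 1 < n\<close>.  In that case the intersection
  of \<open>d + 1\<close> independent random trees is a supercritical branching process.  It survives with
  positive probability by the second moment method, while almost every tuple is mutually random by
  Fubini's theorem; hence the degree of intersectability is not \<open>d\<close>.\<close>

section \<open>Functions recursive in an oracle\<close>

text \<open>Both halves face one obstacle: a code lists its digits in the order in which nodes are
  reached, so the digit that decides whether a word stays in the tree sits at a position depending
  on all earlier digits. The test recomputes this position from the code, whereas the probability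
  estimates move the randomness to independent labels on words. The two children of a node are not
  independent, but both are present with probability 1 - 2 p \<le> q^2. Hence two words lie in the
  tree together with probability at most q to the number of distinct edges on their two paths, and
  the second moment is bounded by that of independent edges. For d + 1 trees, q is replaced by
  \<theta> = q^(d + 1). The test yields only the weak bound q^n \<ge> 1/2. The strict inequality
  required for supercriticality comes from d + 1 < n if p > 0, and from q = 1 if p = 0.\<close>

definition recursive_in :: "(nat \<Rightarrow> nat) \<Rightarrow> nat \<Rightarrow> (nat list \<Rightarrow> nat) \<Rightarrow> bool" where
  "recursive_in A k f \<longleftrightarrow> (\<exists>e. \<forall>xs. length xs = k \<longrightarrow> computes A e xs (f xs))"

lemma recursive_in_cong:
  "recursive_in A k f \<Longrightarrow> (\<And>xs. length xs = k \<Longrightarrow> f xs = g xs) \<Longrightarrow> recursive_in A k g"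
  unfolding recursive_in_def by metis

lemma recursive_in_nth: "i < k \<Longrightarrow> recursive_in A k (\<lambda>xs. xs ! i)"
  unfolding recursive_in_def by (auto intro!: exI[of _ "Proj i"] computes.proj)

lemma recursive_in_drop_nth: "j + i < k \<Longrightarrow> recursive_in A k (\<lambda>xs. drop j xs ! i)"
  by (rule recursive_in_cong[OF recursive_in_nth[of "j + i"]]) (simp_all add: nth_drop)

lemma recursive_in_comp:
  assumes g: "recursive_in A (length fs) g" and fs: "\<And>f. f \<in> set fs \<Longrightarrow> recursive_in A k f"
  shows "recursive_in A k (\<lambda>xs. g (map (\<lambda>f. f xs) fs))"
proof -
  obtain e where e: "\<And>ys. length ys = length fs \<Longrightarrow> computes A e ys (g ys)"
    using g unfolding recursive_in_def by blast
  have "\<exists>es. \<forall>xs. length xs = k \<longrightarrow> list_all2 (\<lambda>e y. computes A e xs y) es (map (\<lambda>f. f xs) fs)"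
    using fs
  proof (induction fs)
    case (Cons f fs)
    obtain es where "\<forall>xs. length xs = k \<longrightarrow>
        list_all2 (\<lambda>e y. computes A e xs y) es (map (\<lambda>f. f xs) fs)"
      using Cons by auto
    moreover obtain e' where "\<forall>xs. length xs = k \<longrightarrow> computes A e' xs (f xs)"
      using Cons.prems[of f] unfolding recursive_in_def by auto
    ultimately show ?case by (intro exI[of _ "e' # es"]) simp
  qed simp
  then obtain es where "\<And>xs. length xs = k \<Longrightarrow>
      list_all2 (\<lambda>e y. computes A e xs y) es (map (\<lambda>f. f xs) fs)"
    by blast
  with e show ?thesis
    unfolding recursive_in_def by (intro exI[of _ "Comp e es"]) (auto intro!: computes.comp)
qed

lemma recursive_in_comp1:
  "recursive_in A 1 (\<lambda>ys. g (ys ! 0)) \<Longrightarrow> recursive_in A k a \<Longrightarrow> recursive_in A k (\<lambda>xs. g (a xs))"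
  using recursive_in_comp[of A "[a]" "\<lambda>ys. g (ys ! 0)" k] by simp

lemma recursive_in_Suc:
  assumes "recursive_in A k a"
  shows "recursive_in A k (\<lambda>xs. Suc (a xs))"
proof (rule recursive_in_comp1[OF _ assms])
  have "computes A Succ xs (Suc (xs ! 0))" if "length xs = 1" for xs
    using that computes.succ[of A "xs ! 0"] by (cases xs) auto
  then show "recursive_in A 1 (\<lambda>ys. Suc (ys ! 0))" unfolding recursive_in_def by blast
qed

lemma recursive_in_const: "recursive_in A k (\<lambda>xs. c)"
proof (induction c)
  case 0
  show ?case unfolding recursive_in_def by (auto intro!: exI[of _ Zero] computes.zero)
qed (rule recursive_in_Suc)

text \<open>\<open>PrimRec\<close> recurses on its first argument, so it is composed with
  \<open>b\<close> followed by all \<open>k\<close> projections. The step function receives the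
  counter and the previous value in front of the parameters, hence \<open>drop 2\<close>.\<close>

lemma recursive_in_rec_nat:
  assumes b: "recursive_in A k b" and f: "recursive_in A k f"
    and g: "recursive_in A (Suc (Suc k)) (\<lambda>ys. g (ys ! 0) (ys ! 1) (drop 2 ys))"
  shows "recursive_in A k (\<lambda>xs. rec_nat (f xs) (\<lambda>m r. g m r xs) (b xs))"
proof -
  obtain ef where ef: "\<And>xs. length xs = k \<Longrightarrow> computes A ef xs (f xs)"
    using f unfolding recursive_in_def by blast
  obtain eg where eg: "\<And>ys. length ys = Suc (Suc k) \<Longrightarrow>
      computes A eg ys (g (ys ! 0) (ys ! 1) (drop 2 ys))"
    using g unfolding recursive_in_def by blast
  have rec: "computes A (PrimRec ef eg) (m # xs) (rec_nat (f xs) (\<lambda>m r. g m r xs) m)"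
    if "length xs = k" for m xs
  proof (induction m)
    case 0
    then show ?case using ef that by (auto intro: computes.primrec_0)
  next
    case (Suc m)
    then show ?case
      using eg[of "m # rec_nat (f xs) (\<lambda>m r. g m r xs) m # xs"] that
      by (auto intro!: computes.primrec_Suc)
  qed
  have "computes A (PrimRec ef eg) ys
      (rec_nat (f (drop 1 ys)) (\<lambda>m r. g m r (drop 1 ys)) (ys ! 0))" if "length ys = Suc k" for ys
    using that rec by (cases ys) auto
  then have "recursive_in A (Suc k)
      (\<lambda>ys. rec_nat (f (drop 1 ys)) (\<lambda>m r. g m r (drop 1 ys)) (ys ! 0))"
    unfolding recursive_in_def by blast
  then have "recursive_in A k (\<lambda>xs. (\<lambda>ys. rec_nat (f (drop 1 ys)) (\<lambda>m r. g m r (drop 1 ys)) (ys ! 0))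
      (map (\<lambda>f. f xs) (b # map (\<lambda>i xs. xs ! i) [0..<k])))"
    by (intro recursive_in_comp) (auto intro: b recursive_in_nth)
  then show ?thesis
  proof (rule recursive_in_cong)
    fix xs :: "nat list" assume "length xs = k"
    then have "map ((!) xs) [0..<k] = xs" using map_nth[of xs] by simp
    then show "(\<lambda>ys. rec_nat (f (drop 1 ys)) (\<lambda>m r. g m r (drop 1 ys)) (ys ! 0))
      (map (\<lambda>f. f xs) (b # map (\<lambda>i xs. xs ! i) [0..<k])) =
      rec_nat (f xs) (\<lambda>m r. g m r xs) (b xs)" by (simp add: comp_def)
  qed
qed

lemma recursive_in_add:
  assumes "recursive_in A k a" "recursive_in A k b"
  shows "recursive_in A k (\<lambda>xs. a xs + b xs)"
proof -
  have "recursive_in A k (\<lambda>xs. rec_nat (a xs) (\<lambda>m r. Suc r) (b xs))"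
    by (intro recursive_in_rec_nat assms recursive_in_Suc recursive_in_nth) simp
  moreover have "rec_nat m (\<lambda>m r. Suc r) n = m + n" for m n by (induction n) auto
  ultimately show ?thesis by simp
qed

lemma recursive_in_mult:
  assumes "recursive_in A k a" "recursive_in A k b"
  shows "recursive_in A k (\<lambda>xs. a xs * b xs)"
proof -
  \<comment> \<open>The step function has two extra arguments in front, so \<open>a\<close> is
    composed with projections shifted by 2.\<close>
  have a: "recursive_in A (Suc (Suc k)) (\<lambda>ys. a (drop 2 ys))"
  proof (rule recursive_in_cong)
    show "recursive_in A (Suc (Suc k)) (\<lambda>ys. a (map (\<lambda>f. f ys) (map (\<lambda>i ys. ys ! (i + 2)) [0..<k])))"
      using assms(1) by (intro recursive_in_comp) (auto intro!: recursive_in_nth)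
    fix ys :: "nat list" assume "length ys = Suc (Suc k)"
    then have "map (\<lambda>f. f ys) (map (\<lambda>i ys. ys ! (i + 2)) [0..<k]) = drop 2 ys"
      by (intro nth_equalityI) (auto simp: nth_drop add.commute)
    then show "a (map (\<lambda>f. f ys) (map (\<lambda>i ys. ys ! (i + 2)) [0..<k])) = a (drop 2 ys)" by simp
  qed
  have "recursive_in A k (\<lambda>xs. rec_nat 0 (\<lambda>m r. r + a xs) (b xs))"
    by (intro recursive_in_rec_nat assms recursive_in_add recursive_in_nth recursive_in_const a) simp
  moreover have "rec_nat 0 (\<lambda>m r. r + c) n = c * n" for c n :: nat by (induction n) auto
  ultimately show ?thesis by simp
qed

lemma recursive_in_pred:
  assumes "recursive_in A k a"
  shows "recursive_in A k (\<lambda>xs. a xs - 1)"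
proof -
  have "recursive_in A k (\<lambda>xs. rec_nat 0 (\<lambda>m r. m) (a xs))"
    by (intro recursive_in_rec_nat assms recursive_in_nth recursive_in_const) simp
  moreover have "rec_nat 0 (\<lambda>m r. m) n = n - 1" for n by (cases n) auto
  ultimately show ?thesis by simp
qed

lemma recursive_in_diff:
  assumes "recursive_in A k a" "recursive_in A k b"
  shows "recursive_in A k (\<lambda>xs. a xs - b xs)"
proof -
  have "recursive_in A k (\<lambda>xs. rec_nat (a xs) (\<lambda>m r. r - 1) (b xs))"
    by (intro recursive_in_rec_nat assms recursive_in_pred recursive_in_nth) simp
  moreover have "rec_nat m (\<lambda>m r. r - 1) n = m - n" for m n :: nat by (induction n) auto
  ultimately show ?thesis by simp
qed

text \<open>Bounded sums do the work of bounded search: bounded quantifiers, the inverse of the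
  pairing function and the length of a coded list are all written as such sums.\<close>

lemma recursive_in_sum:
  assumes b: "recursive_in A k b" and f: "recursive_in A (Suc k) (\<lambda>ys. f (ys ! 0) (drop 1 ys))"
  shows "recursive_in A k (\<lambda>xs. \<Sum>i<b xs. f i xs)"
proof -
  have "recursive_in A (Suc (Suc k)) (\<lambda>ys. f (ys ! 0) (drop 2 ys))"
  proof (rule recursive_in_cong)
    let ?fs = "(\<lambda>ys. ys ! 0) # map (\<lambda>i ys. ys ! (i + 2)) [0..<k]"
    show "recursive_in A (Suc (Suc k)) (\<lambda>ys. (\<lambda>ys. f (ys ! 0) (drop 1 ys)) (map (\<lambda>f. f ys) ?fs))"
      using f by (intro recursive_in_comp) (auto intro!: recursive_in_nth)
    fix ys :: "nat list" assume "length ys = Suc (Suc k)"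
    then have "map (\<lambda>f. f ys) (map (\<lambda>i ys. ys ! (i + 2)) [0..<k]) = drop 2 ys"
      by (intro nth_equalityI) (auto simp: nth_drop add.commute)
    then show "(\<lambda>ys. f (ys ! 0) (drop 1 ys)) (map (\<lambda>f. f ys) ?fs) = f (ys ! 0) (drop 2 ys)" by simp
  qed
  then have "recursive_in A k (\<lambda>xs. rec_nat 0 (\<lambda>m r. r + f m xs) (b xs))"
    by (intro recursive_in_rec_nat recursive_in_add recursive_in_nth recursive_in_const b) auto
  moreover have "rec_nat 0 (\<lambda>m r. r + g m) n = (\<Sum>i<n. g i)" for g :: "nat \<Rightarrow> nat" and n
    by (induction n) auto
  ultimately show ?thesis by simp
qed

lemma recursive_in_le:
  assumes "recursive_in A k a" "recursive_in A k b"
  shows "recursive_in A k (\<lambda>xs. of_bool (a xs \<le> b xs))"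
proof -
  have "recursive_in A k (\<lambda>xs. 1 - (a xs - b xs))"
    by (intro recursive_in_diff recursive_in_const assms)
  then show ?thesis by (rule recursive_in_cong) auto
qed

lemma recursive_in_less:
  assumes "recursive_in A k a" "recursive_in A k b"
  shows "recursive_in A k (\<lambda>xs. of_bool (a xs < b xs))"
  using recursive_in_le[OF recursive_in_Suc[OF assms(1)] assms(2)] by (simp add: Suc_le_eq)

lemma recursive_in_not:
  assumes "recursive_in A k (\<lambda>xs. of_bool (P xs))"
  shows "recursive_in A k (\<lambda>xs. of_bool (\<not> P xs))"
  using recursive_in_diff[OF recursive_in_const[of A k 1] assms]
  by (rule recursive_in_cong) auto

lemma recursive_in_conj:
  assumes "recursive_in A k (\<lambda>xs. of_bool (P xs))" "recursive_in A k (\<lambda>xs. of_bool (Q xs))"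
  shows "recursive_in A k (\<lambda>xs. of_bool (P xs \<and> Q xs))"
  using recursive_in_mult[OF assms] by (rule recursive_in_cong) auto

lemma recursive_in_disj:
  assumes "recursive_in A k (\<lambda>xs. of_bool (P xs))" "recursive_in A k (\<lambda>xs. of_bool (Q xs))"
  shows "recursive_in A k (\<lambda>xs. of_bool (P xs \<or> Q xs))"
  using recursive_in_not[OF recursive_in_conj[OF assms[THEN recursive_in_not]]]
  by simp

lemma recursive_in_eq:
  assumes "recursive_in A k a" "recursive_in A k b"
  shows "recursive_in A k (\<lambda>xs. of_bool (a xs = b xs))"
  using recursive_in_conj[OF recursive_in_le[OF assms] recursive_in_le[OF assms(2,1)]]
  by (rule recursive_in_cong) auto

lemma recursive_in_all:
  assumes "recursive_in A k b"
    and "recursive_in A (Suc k) (\<lambda>ys. of_bool (P (ys ! 0) (drop 1 ys)))"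
  shows "recursive_in A k (\<lambda>xs. of_bool (\<forall>i<b xs. P i xs))"
proof -
  have "recursive_in A k (\<lambda>xs. of_bool ((\<Sum>i<b xs. of_bool (\<not> P i xs) :: nat) = 0))"
    by (intro recursive_in_eq recursive_in_sum recursive_in_not recursive_in_const assms)
  then show ?thesis by (rule recursive_in_cong) auto
qed

lemmas recursive_in_intros =
  recursive_in_const recursive_in_nth recursive_in_drop_nth recursive_in_Suc recursive_in_add
  recursive_in_mult recursive_in_pred recursive_in_diff recursive_in_sum recursive_in_le
  recursive_in_less recursive_in_not recursive_in_conj recursive_in_disj recursive_in_eq
  recursive_in_all

section \<open>Coding of pairs and lists\<close>

lemma triangle_eq_sum: "triangle n = (\<Sum>i<Suc n. i)"
  by (induction n) auto

lemma recursive_in_prod_encode: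
  assumes "recursive_in A k a" "recursive_in A k b"
  shows "recursive_in A k (\<lambda>xs. prod_encode (a xs, b xs))"
  unfolding prod_encode_def prod.case triangle_eq_sum
  by (intro recursive_in_intros assms) simp

lemma prod_decode_bounds: "fst (prod_decode z) < Suc z" "snd (prod_decode z) < Suc z"
  using le_prod_encode_1[of "fst (prod_decode z)" "snd (prod_decode z)"]
    le_prod_encode_2[of "snd (prod_decode z)" "fst (prod_decode z)"] by simp_all

text \<open>Both components of the pair coded by \<open>z\<close> are at most \<open>z\<close>, and
  the pair is unique, so exactly one term of the double sum carries a nonzero indicator. Decoding
  thereby becomes a bounded sum.\<close>

lemma sum_prod_decode:
  fixes f :: "nat \<Rightarrow> nat \<Rightarrow> nat"
  shows "(\<Sum>i<Suc z. \<Sum>j<Suc z. f i j * of_bool (z = prod_encode (i, j))) =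
    f (fst (prod_decode z)) (snd (prod_decode z))"
proof -
  have eq: "z = prod_encode (i, j) \<longleftrightarrow> i = fst (prod_decode z) \<and> j = snd (prod_decode z)" for i j
    by (metis prod.collapse prod_decode_inverse prod_encode_inverse fst_conv snd_conv)
  have "(\<Sum>j<Suc z. f i j * of_bool (z = prod_encode (i, j))) =
      (if i = fst (prod_decode z) then f i (snd (prod_decode z)) else 0)" for i
    unfolding eq using prod_decode_bounds(2)[of z]
    by (subst sum.mono_neutral_right[of _ "{snd (prod_decode z)}"]) auto
  then show ?thesis
    using prod_decode_bounds(1)[of z]
    by (simp add: sum.delta' del: sum.lessThan_Suc)
qed

lemma recursive_in_fst_prod_decode:
  assumes "recursive_in A k a"
  shows "recursive_in A k (\<lambda>xs. fst (prod_decode (a xs)))"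
proof (rule recursive_in_comp1[OF _ assms])
  show "recursive_in A 1 (\<lambda>xs. fst (prod_decode (xs ! 0)))"
    unfolding sum_prod_decode[of "\<lambda>i j. i", symmetric]
    by (intro recursive_in_intros recursive_in_prod_encode; simp add: recursive_in_nth
        recursive_in_drop_nth)
qed

lemma recursive_in_snd_prod_decode:
  assumes "recursive_in A k a"
  shows "recursive_in A k (\<lambda>xs. snd (prod_decode (a xs)))"
proof (rule recursive_in_comp1[OF _ assms])
  show "recursive_in A 1 (\<lambda>xs. snd (prod_decode (xs ! 0)))"
    unfolding sum_prod_decode[of "\<lambda>i j. j", symmetric]
    by (intro recursive_in_intros recursive_in_prod_encode; simp add: recursive_in_nth
        recursive_in_drop_nth)
qed

text \<open>The default value turns a finite word into a total sequence, so that notions defined for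
  sequences, such as \<open>node_position\<close>, apply to words directly.\<close>

definition nth_or_0 :: "nat list \<Rightarrow> nat \<Rightarrow> nat" where
  "nth_or_0 xs i = (if i < length xs then xs ! i else 0)"

lemma prod_decode_0 [simp]: "prod_decode 0 = (0, 0)"
  by (simp add: prod_decode_def prod_decode_aux.simps)

text \<open>As \<open>prod_decode 0 = (0, 0)\<close>, the empty list needs no case distinction: its code \<open>0\<close> has
  head and tail \<open>0\<close>.\<close>

lemma list_encode_tl: "snd (prod_decode (list_encode xs - 1)) = list_encode (tl xs)"
  by (cases xs) simp_all

lemma list_encode_hd: "fst (prod_decode (list_encode xs - 1)) = nth_or_0 xs 0"
  by (cases xs) (simp_all add: nth_or_0_def)

lemma list_encode_drop:
  "rec_nat (list_encode xs) (\<lambda>m r. snd (prod_decode (r - 1))) n = list_encode (drop n xs)"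
  by (induction n) (simp_all only: old.nat.rec list_encode_tl tl_drop drop_Suc drop_0)

lemma recursive_in_drop:
  assumes "recursive_in A k a" "recursive_in A k b"
  shows "recursive_in A k (\<lambda>xs. list_encode (drop (b xs) (list_decode (a xs))))"
  unfolding list_encode_drop[symmetric] list_decode_inverse
  by (intro recursive_in_rec_nat recursive_in_snd_prod_decode recursive_in_pred recursive_in_nth
      assms) simp

lemma recursive_in_nth_or_0:
  assumes "recursive_in A k a" "recursive_in A k b"
  shows "recursive_in A k (\<lambda>xs. nth_or_0 (list_decode (a xs)) (b xs))"
proof -
  have "recursive_in A k
      (\<lambda>xs. fst (prod_decode (list_encode (drop (b xs) (list_decode (a xs))) - 1)))"
    by (intro recursive_in_fst_prod_decode recursive_in_pred recursive_in_drop assms)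
  then show ?thesis unfolding list_encode_hd
    by (rule recursive_in_cong) (auto simp: nth_or_0_def)
qed

lemma length_le_list_encode: "length xs \<le> list_encode xs"
proof (induction xs)
  case (Cons x xs)
  then show ?case using le_prod_encode_2[of "list_encode xs" x] by simp
qed simp

lemma recursive_in_length:
  assumes "recursive_in A k a"
  shows "recursive_in A k (\<lambda>xs. length (list_decode (a xs)))"
proof (rule recursive_in_comp1[OF _ assms])
  \<comment> \<open>The \<open>i\<close>-th tail has nonzero code exactly while \<open>i\<close> is
    below the length, and the length never exceeds the code, so the range of summation is large
    enough.\<close>
  have sum: "(\<Sum>i<z. of_bool (\<not> list_encode (drop i (list_decode z)) = 0) :: nat) = length (list_decode z)"
    (is "?s = _") for z
  proof -
    have "?s = card ({..<z} \<inter> {i. i < length (list_decode z)})"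
      using list_encode_eq[of _ "[]"]
      by (simp add: sum_of_bool_eq not_le flip: list_encode.simps(1))
    also have "{..<z} \<inter> {i. i < length (list_decode z)} = {..<length (list_decode z)}"
      using length_le_list_encode[of "list_decode z"] by auto
    finally show ?thesis by simp
  qed
  show "recursive_in A 1 (\<lambda>xs. length (list_decode (xs ! 0)))"
    unfolding sum[symmetric]
    by (intro recursive_in_intros recursive_in_drop; simp)
qed

section \<open>Positions of nodes\<close>

lemma length_initial [simp]: "length (initial x r) = r"
  by (simp add: initial_def)

lemma nth_initial [simp]: "i < r \<Longrightarrow> initial x r ! i = x i"
  by (simp add: initial_def)

lemma initial_nth: "initial ((!) \<sigma>) (length \<sigma>) = \<sigma>"
  by (simp add: initial_def map_nth)

lemma initial_eq_iff: "initial x (length w) = w \<longleftrightarrow> (\<forall>j<length w. x j = w ! j)"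
  using list_eq_iff_nth_eq[of "initial x (length w)" w] by simp

lemma length_nodes_eq: "length (nodes x k) = Suc (\<Sum>j<k. Suc (of_bool (2 \<le> x j)))"
  by (induction k) (auto simp: successors_def)

text \<open>The children of the \<open>k\<close>-th node are appended at position \<open>length (nodes x k)\<close>, which is the
  sum below; \<open>s\<close> gives the directions taken from the root.\<close>

definition node_position :: "(nat \<Rightarrow> nat) \<Rightarrow> (nat \<Rightarrow> nat) \<Rightarrow> nat \<Rightarrow> nat" where
  "node_position x s t = rec_nat 0
    (\<lambda>t k. Suc (\<Sum>j<k. Suc (of_bool (2 \<le> x j))) + of_bool (2 \<le> x k) * s t) t"

lemma node_position_simps [simp]:
  "node_position x s 0 = 0"
  "node_position x s (Suc t) = Suc (\<Sum>j<node_position x s t. Suc (of_bool (2 \<le> x j))) +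
    of_bool (2 \<le> x (node_position x s t)) * s t"
  by (simp_all add: node_position_def)

text \<open>Digits above 2 act like 2, as they do in \<open>successors\<close>; the facts about
  trees then hold for arbitrary sequences, not only for ternary ones.\<close>

definition permits :: "nat \<Rightarrow> bool \<Rightarrow> bool" where
  "permits a b \<longleftrightarrow> 2 \<le> a \<or> a = of_bool b"

lemma in_successors_iff: "\<sigma> @ [b] \<in> set (successors a \<sigma>) \<longleftrightarrow> permits a b"
  by (auto simp: successors_def permits_def)

lemma tree_child_iff: "nodes x k ! k @ [b] \<in> tree x \<longleftrightarrow> permits (x k) b"
  by (simp add: tree_child in_successors_iff)

lemma node_at_position:
  assumes "\<And>t. t < r \<Longrightarrow> permits (x (node_position x (\<lambda>i. of_bool (z i)) t)) (z t)"
  shows "nodes x (node_position x (\<lambda>i. of_bool (z i)) r) ! node_position x (\<lambda>i. of_bool (z i)) r = initial z r"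
  using assms
proof (induction r)
  case (Suc r)
  define k where "k = node_position x (\<lambda>i. of_bool (z i)) r"
  have k: "nodes x k ! k = initial z r" "permits (x k) (z r)"
    using Suc by (simp_all add: k_def)
  define k' where "k' = node_position x (\<lambda>i. of_bool (z i)) (Suc r)"
  have k': "k' = length (nodes x k) + of_bool (2 \<le> x k) * of_bool (z r)"
    using length_nodes_eq[of x k] by (simp add: k'_def k_def)
  have *: "nodes x (Suc k) ! k' = initial z (Suc r)" "k' < length (nodes x (Suc k))"
    using k
    by (auto simp: k' successors_def permits_def nth_append initial_Suc)
  then show ?case using nodes_nth[OF *(2)] by (simp add: k'_def)
qed simp

text \<open>Once the path has left the tree, \<open>node_position\<close> need not point at a node
  of it any more. The equivalence survives because the first forbidden step is still read at a
  correct position.\<close>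

lemma initial_in_tree_iff:
  "initial z r \<in> tree x \<longleftrightarrow>
    (\<forall>t<r. permits (x (node_position x (\<lambda>i. of_bool (z i)) t)) (z t))"
proof (induction r)
  case 0
  then show ?case by (simp add: tree_iff)
next
  case (Suc r)
  show ?case
  proof (cases "initial z r \<in> tree x")
    case True
    define k where "k = node_position x (\<lambda>i. of_bool (z i)) r"
    have "nodes x k ! k = initial z r"
      unfolding k_def using Suc True by (intro node_at_position) blast
    then have "initial z (Suc r) \<in> tree x \<longleftrightarrow> permits (x k) (z r)"
      using tree_child_iff[of x k "z r"] by (simp add: initial_Suc)
    then show ?thesis using Suc True by (auto simp: k_def less_Suc_eq)
  next
    case False
    then have "initial z (Suc r) \<notin> tree x" using tree_prefix[of "initial z r" "z r" x]
      by (auto simp: initial_Suc)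
    then show ?thesis using Suc False less_SucI by blast
  qed
qed

section \<open>A test against members of small dimension\<close>

inductive_cases computes_ZeroE: "computes A Zero xs y"
inductive_cases computes_SuccE: "computes A Succ xs y"
inductive_cases computes_ProjE: "computes A (Proj i) xs y"
inductive_cases computes_QueryE: "computes A Query xs y"
inductive_cases computes_CompE: "computes A (Comp f gs) xs y"
inductive_cases computes_PrimRec_0E: "computes A (PrimRec f g) (0 # xs) y"
inductive_cases computes_PrimRec_SucE: "computes A (PrimRec f g) (Suc m # xs) y"
inductive_cases computes_MinimE: "computes A (Minim f) xs y"

lemma computes_deterministic: "computes A e xs y \<Longrightarrow> computes A e xs y' \<Longrightarrow> y = y'"
proof (induction arbitrary: y' rule: computes.induct)
  case (zero xs)
  then show ?case by (rule computes_ZeroE) simp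
next
  case (succ x)
  then show ?case by (rule computes_SuccE) simp
next
  case (proj i xs)
  from proj.prems show ?case by (rule computes_ProjE) simp
next
  case (query x)
  then show ?case by (rule computes_QueryE) simp
next
  case (comp xs gs ys f z)
  from comp.prems obtain ys' where ys': "list_all2 (\<lambda>g y. computes A g xs y) gs ys'"
    and z: "computes A f ys' y'" by (rule computes_CompE)
  have "ys = ys'"
    using comp.IH(1) ys' by (auto simp: list_all2_conv_all_nth intro!: nth_equalityI)
  with comp.IH(2) z show ?case by simp
next
  case (primrec_0 f xs y g)
  from primrec_0.prems have "computes A f xs y'" by (rule computes_PrimRec_0E)
  then show ?case by (rule primrec_0.IH)
next
  case (primrec_Suc f g m xs r y)
  from primrec_Suc.prems obtain r' where "computes A (PrimRec f g) (m # xs) r'"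
    and "computes A g (m # r' # xs) y'" by (rule computes_PrimRec_SucE)
  with primrec_Suc.IH show ?case by metis
next
  case (minim f m xs)
  from minim.prems have m': "computes A f (y' # xs) 0 \<and>
    (\<forall>k<y'. \<exists>y. computes A f (k # xs) (Suc y))" by (rule computes_MinimE) blast
  \<comment> \<open>The smaller of two search results would have value 0 for one search and a
    positive value for the other.\<close>
  have "\<not> m < y'" using minim.IH(1) m' by (metis nat.distinct(1))
  moreover have "\<not> y' < m" using minim.IH(2) m' by (metis nat.distinct(1))
  ultimately show ?case by simp
qed

text \<open>The body of the minimization ignores its search variable, which is argument 0 of the
  four. So the search stops at 0 if \<open>D\<close> holds and runs forever otherwise, which turns a
  decidable check into convergence.\<close>

lemma partial_recursive_domain:
  assumes z: "recursive_in A 2 (\<lambda>xs. z (xs ! 0) (xs ! 1))"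
    and D: "recursive_in A 4 (\<lambda>xs. of_bool (D (xs ! 1) (xs ! 2) (xs ! 3)))"
  shows "\<exists>e. \<forall>m w. (\<exists>v. computes A e [m, w] v) \<longleftrightarrow>
    (\<exists>y. computes A u [z m w] y \<and> D m w y)"
proof -
  obtain ez where ez: "\<And>xs. length xs = 2 \<Longrightarrow> computes A ez xs (z (xs ! 0) (xs ! 1))"
    using z unfolding recursive_in_def by blast
  obtain g where g: "\<And>xs. length xs = 4 \<Longrightarrow>
      computes A g xs (of_bool (\<not> D (xs ! 1) (xs ! 2) (xs ! 3)))"
    using recursive_in_not[OF D] unfolding recursive_in_def by blast
  define e where "e = Comp (Minim g) [Proj 0, Proj 1, Comp u [ez]]"
  have "(\<exists>v. computes A e [m, w] v) \<longleftrightarrow> (\<exists>y. computes A u [z m w] y \<and> D m w y)" for m w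
  proof
    assume "\<exists>v. computes A e [m, w] v"
    then obtain v where "computes A (Comp (Minim g) [Proj 0, Proj 1, Comp u [ez]]) [m, w] v"
      by (auto simp: e_def)
    then obtain m' w' y where "computes A (Proj 0) [m, w] m'" "computes A (Proj 1) [m, w] w'"
      and y: "computes A (Comp u [ez]) [m, w] y" and v: "computes A (Minim g) [m', w', y] v"
      by (rule computes_CompE) (auto simp: list_all2_Cons1)
    then have [simp]: "m' = m" "w' = w" by (auto elim: computes_ProjE)
    from y obtain z' where "computes A ez [m, w] z'" and u: "computes A u [z'] y"
      by (auto elim!: computes_CompE simp: list_all2_Cons1)
    then have [simp]: "z' = z m w" using ez[of "[m, w]"] by (auto dest: computes_deterministic)
    from v have "computes A g [v, m, w, y] 0" by (auto elim: computes_MinimE)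
    from computes_deterministic[OF this g] have "D m w y" by simp
    with u show "\<exists>y. computes A u [z m w] y \<and> D m w y" by auto
  next
    assume "\<exists>y. computes A u [z m w] y \<and> D m w y"
    then obtain y where y: "computes A u [z m w] y" "D m w y" by blast
    have "computes A (Comp u [ez]) [m, w] y"
      using ez[of "[m, w]"] y(1) by (auto intro!: computes.comp[where ys = "[z m w]"])
    moreover have "computes A (Minim g) [m, w, y] 0"
      using g[of "[0, m, w, y]"] y(2) by (auto intro!: computes.minim)
    ultimately have "computes A e [m, w] 0"
      unfolding e_def
      using computes.proj[of 0 "[m, w]" A] computes.proj[of 1 "[m, w]" A]
      by (auto intro!: computes.comp[where ys = "[m, w, y]"])
    then show "\<exists>v. computes A e [m, w] v" by blast
  qed
  then show ?thesis by blast
qed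

text \<open>The program \<open>\<rho>\<close> of the machine is read off the length of the word, so that the test consists
  of the words for which a single computation of the machine halts and passes a decidable
  check; no dovetailing is required.\<close>

definition compressible_test ::
    "(bool list \<Rightarrow> bool list option) \<Rightarrow> nat \<Rightarrow> nat \<Rightarrow> nat \<Rightarrow> nat \<Rightarrow> nat list set" where
  "compressible_test U a b c m = {w. \<exists>\<rho> \<sigma>. bits_encode \<rho> = fst (prod_decode (length w)) \<and>
    U \<rho> = Some \<sigma> \<and> c * Suc m \<le> length \<sigma> \<and> b * length \<rho> < a * length \<sigma> \<and>
    (\<forall>t<length \<sigma>. node_position (nth_or_0 w) (\<lambda>i. of_bool (\<sigma> ! i)) t < length w \<and>
      permits (nth_or_0 w (node_position (nth_or_0 w) (\<lambda>i. of_bool (\<sigma> ! i)) t)) (\<sigma> ! t))}"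

lemma list_decode_bits_encode [simp]: "list_decode (bits_encode \<sigma>) = map of_bool \<sigma>"
  by (simp add: bits_encode_def)

text \<open>A program for a machine is unspecified on numbers that do not code bit lists. The
  right-hand side is the decidable check that excludes such inputs from the test.\<close>

lemma bits_encode_range:
  "(\<exists>\<rho>. z = bits_encode \<rho>) \<longleftrightarrow> (\<forall>i<length (list_decode z). nth_or_0 (list_decode z) i < 2)"
    (is "_ \<longleftrightarrow> ?R")
proof
  assume ?R
  then have "\<forall>v\<in>set (list_decode z). v < 2" by (auto simp: nth_or_0_def in_set_conv_nth)
  then have "map of_bool (map (\<lambda>v. v = 1) (list_decode z)) = list_decode z"
    unfolding map_map by (intro map_idI) (auto simp: less_2_cases_iff)
  then have "z = bits_encode (map (\<lambda>v. v = 1) (list_decode z))"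
    by (metis bits_encode_def list_decode_inverse)
  then show "\<exists>\<rho>. z = bits_encode \<rho>" ..
qed (auto simp: nth_or_0_def)

lemma node_position_cong:
  assumes "\<And>i. i < t \<Longrightarrow> s i = s' i"
  shows "node_position x s t = node_position x s' t"
  using assms by (induction t) auto

lemma recursive_in_node_position:
  assumes "recursive_in A k w" "recursive_in A k y" "recursive_in A k t"
  shows "recursive_in A k (\<lambda>xs. node_position (nth_or_0 (list_decode (w xs)))
    (nth_or_0 (list_decode (y xs))) (t xs))"
proof -
  have "recursive_in A (length [w, y, t]) (\<lambda>xs. node_position (nth_or_0 (list_decode (xs ! 0)))
    (nth_or_0 (list_decode (xs ! 1))) (xs ! 2))"
    unfolding node_position_def
    by (intro recursive_in_rec_nat recursive_in_intros recursive_in_nth_or_0)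
      (simp_all add: recursive_in_drop_nth)
  from recursive_in_comp[OF this, of k] assms show ?thesis by auto
qed

lemma uniformly_ce_compressible_test:
  assumes "partial_computable_machine U"
  shows "uniformly_ce no_oracle (compressible_test U a b c)"
proof -
  obtain u where u: "\<And>\<rho> y. computes no_oracle u [bits_encode \<rho>] y \<longleftrightarrow>
      (\<exists>\<sigma>. U \<rho> = Some \<sigma> \<and> y = bits_encode \<sigma>)"
    using assms unfolding partial_computable_machine_def by blast
  define z where "z w = fst (prod_decode (length (list_decode w)))" for w
  define pos where "pos w y = node_position (nth_or_0 (list_decode w)) (nth_or_0 (list_decode y))"
    for w y
  define D where "D m w y \<longleftrightarrow>
      (\<forall>i<length (list_decode (z w)). nth_or_0 (list_decode (z w)) i < 2) \<and>
      c * Suc m \<le> length (list_decode y) \<and>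
      b * length (list_decode (z w)) < a * length (list_decode y) \<and>
      (\<forall>t<length (list_decode y). pos w y t < length (list_decode w) \<and>
        (2 \<le> nth_or_0 (list_decode w) (pos w y t) \<or>
         nth_or_0 (list_decode w) (pos w y t) = nth_or_0 (list_decode y) t))" for m w y
  have rec_z: "recursive_in no_oracle k (\<lambda>xs. z (f xs))" if "recursive_in no_oracle k f" for k f
    unfolding z_def by (intro recursive_in_fst_prod_decode recursive_in_length that)
  have "\<exists>e. \<forall>m w. (\<exists>v. computes no_oracle e [m, w] v) \<longleftrightarrow>
      (\<exists>y. computes no_oracle u [z w] y \<and> D m w y)"
  proof (rule partial_recursive_domain)
    show "recursive_in no_oracle 2 (\<lambda>xs. z (xs ! 1))"
      by (intro rec_z recursive_in_nth) simp
    show "recursive_in no_oracle 4 (\<lambda>xs. of_bool (D (xs ! 1) (xs ! 2) (xs ! 3)))"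
      unfolding D_def pos_def
      by (intro recursive_in_intros recursive_in_length recursive_in_nth_or_0
          recursive_in_node_position rec_z) simp_all
  qed
  moreover have "(\<exists>y. computes no_oracle u [z (list_encode w)] y \<and> D m (list_encode w) y) \<longleftrightarrow>
      w \<in> compressible_test U a b c m" for m w
  proof -
    have D: "D m (list_encode w) (bits_encode \<sigma>) \<longleftrightarrow> c * Suc m \<le> length \<sigma> \<and>
        b * length \<rho> < a * length \<sigma> \<and>
      (\<forall>t<length \<sigma>. node_position (nth_or_0 w) (\<lambda>i. of_bool (\<sigma> ! i)) t < length w \<and>
       permits (nth_or_0 w (node_position (nth_or_0 w) (\<lambda>i. of_bool (\<sigma> ! i)) t)) (\<sigma> ! t))"
      if z: "z (list_encode w) = bits_encode \<rho>" for \<rho> \<sigma>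
    proof -
      have pos: "pos (list_encode w) (bits_encode \<sigma>) t =
          node_position (nth_or_0 w) (\<lambda>i. of_bool (\<sigma> ! i)) t" if "t < length \<sigma>" for t
        unfolding pos_def using that
        by (simp, intro node_position_cong) (simp add: nth_or_0_def)
      have "\<forall>i<length (list_decode (z (list_encode w))).
          nth_or_0 (list_decode (z (list_encode w))) i < 2"
        using z bits_encode_range by blast
      then show ?thesis
        unfolding D_def z by (auto simp: pos permits_def nth_or_0_def[of "map of_bool \<sigma>"])
    qed
    have bits: "\<exists>\<rho>. z (list_encode w) = bits_encode \<rho>" if "D m (list_encode w) y" for y
      using that unfolding bits_encode_range D_def by blast
    have z: "z (list_encode w) = fst (prod_decode (length w))" by (simp add: z_def)
    show ?thesis
    proof
      assume "\<exists>y. computes no_oracle u [z (list_encode w)] y \<and> D m (list_encode w) y"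
      then obtain y where y: "computes no_oracle u [z (list_encode w)] y" "D m (list_encode w) y"
        by blast
      obtain \<rho> where \<rho>: "z (list_encode w) = bits_encode \<rho>" using bits[OF y(2)] by blast
      with y(1) u obtain \<sigma> where "U \<rho> = Some \<sigma>" "y = bits_encode \<sigma>" by auto
      with y(2) D[OF \<rho>] \<rho> z show "w \<in> compressible_test U a b c m"
        unfolding compressible_test_def mem_Collect_eq
        by (intro exI[of _ \<rho>] exI[of _ \<sigma>]) simp
    next
      assume "w \<in> compressible_test U a b c m"
      then obtain \<rho> \<sigma> where *: "bits_encode \<rho> = fst (prod_decode (length w))" "U \<rho> = Some \<sigma>"
        "c * Suc m \<le> length \<sigma> \<and> b * length \<rho> < a * length \<sigma> \<and>
         (\<forall>t<length \<sigma>. node_position (nth_or_0 w) (\<lambda>i. of_bool (\<sigma> ! i)) t < length w \<and>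
      permits (nth_or_0 w (node_position (nth_or_0 w) (\<lambda>i. of_bool (\<sigma> ! i)) t)) (\<sigma> ! t))"
        unfolding compressible_test_def by blast
      then have \<rho>: "z (list_encode w) = bits_encode \<rho>" using z by simp
      moreover have "computes no_oracle u [bits_encode \<rho>] (bits_encode \<sigma>)"
        using u *(2) by blast
      ultimately show "\<exists>y. computes no_oracle u [z (list_encode w)] y \<and> D m (list_encode w) y"
        using D[OF \<rho>, of \<sigma>] *(3) by (intro exI[of _ "bits_encode \<sigma>"]) simp
    qed
  qed
  ultimately show ?thesis unfolding uniformly_ce_def by metis
qed

text \<open>The position after step \<open>t\<close> depends only on digits at indices up to the
  position before it, so agreement below \<open>N\<close> suffices as long as the positions visited
  stay below \<open>N\<close>.\<close>

lemma node_position_agree: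
  assumes "\<And>i. i < N \<Longrightarrow> x i = x' i" and "\<And>t. t < r \<Longrightarrow> node_position x s t < N"
  shows "t < r \<Longrightarrow> node_position x' s t = node_position x s t"
proof (induction t)
  case (Suc t)
  then have "node_position x s t < N" using assms(2) by simp
  then have "(\<Sum>j<node_position x s t. Suc (of_bool (2 \<le> x' j))) =
      (\<Sum>j<node_position x s t. Suc (of_bool (2 \<le> x j)))" "x' (node_position x s t) = x (node_position x s t)"
    using assms(1) by (auto intro!: sum.cong)
  then show ?case using Suc by simp
qed simp

lemma nth_or_0_initial: "i < N \<Longrightarrow> nth_or_0 (initial x N) i = x i"
  by (simp add: nth_or_0_def)

text \<open>Reading the program off the length of the word loses nothing: infinitely many lengths
  have a given first component, so some initial segment of \<open>x\<close> names \<rho> and is also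
  long enough to contain every digit that has to be inspected.\<close>

lemma in_cylinders_compressible_test_iff:
  "x \<in> cylinders (compressible_test U a b c m) \<longleftrightarrow>
    (\<exists>\<rho> \<sigma>. U \<rho> = Some \<sigma> \<and> c * Suc m \<le> length \<sigma> \<and> b * length \<rho> < a * length \<sigma> \<and> \<sigma> \<in> tree x)"
proof
  assume "x \<in> cylinders (compressible_test U a b c m)"
  then obtain N \<rho> \<sigma> where *: "U \<rho> = Some \<sigma>" "c * Suc m \<le> length \<sigma>" "b * length \<rho> < a * length \<sigma>"
    and pos: "\<And>t. t < length \<sigma> \<Longrightarrow>
      node_position (nth_or_0 (initial x N)) (\<lambda>i. of_bool (\<sigma> ! i)) t < N \<and>
      permits (nth_or_0 (initial x N)
        (node_position (nth_or_0 (initial x N)) (\<lambda>i. of_bool (\<sigma> ! i)) t)) (\<sigma> ! t)"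
    unfolding cylinders_def compressible_test_def by auto
  have eq: "node_position x (\<lambda>i. of_bool (\<sigma> ! i)) t =
      node_position (nth_or_0 (initial x N)) (\<lambda>i. of_bool (\<sigma> ! i)) t" if "t < length \<sigma>" for t
    using that pos by (intro node_position_agree[of N]) (auto simp: nth_or_0_initial)
  have "initial ((!) \<sigma>) (length \<sigma>) \<in> tree x"
    unfolding initial_in_tree_iff
  proof (intro allI impI)
    fix t assume t: "t < length \<sigma>"
    show "permits (x (node_position x (\<lambda>i. of_bool (\<sigma> ! i)) t)) (\<sigma> ! t)"
      using pos[OF t] unfolding eq[OF t] by (metis nth_or_0_initial)
  qed
  with * show "\<exists>\<rho> \<sigma>. U \<rho> = Some \<sigma> \<and> c * Suc m \<le> length \<sigma> \<and> b * length \<rho> < a * length \<sigma> \<and>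
      \<sigma> \<in> tree x"
    unfolding initial_nth by blast
next
  assume "\<exists>\<rho> \<sigma>. U \<rho> = Some \<sigma> \<and> c * Suc m \<le> length \<sigma> \<and> b * length \<rho> < a * length \<sigma> \<and>
      \<sigma> \<in> tree x"
  then obtain \<rho> \<sigma> where *: "U \<rho> = Some \<sigma>" "c * Suc m \<le> length \<sigma>" "b * length \<rho> < a * length \<sigma>"
    and \<sigma>: "initial ((!) \<sigma>) (length \<sigma>) \<in> tree x"
    unfolding initial_nth by blast
  define pos where "pos = node_position x (\<lambda>i. of_bool (\<sigma> ! i))"
  \<comment> \<open>\<open>K\<close> exceeds all positions inspected, and the pairing function gives
    \<open>N \<ge> K\<close>.\<close>
  define K where "K = Suc (\<Sum>t<length \<sigma>. pos t)"
  define N where "N = prod_encode (bits_encode \<rho>, K)"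
  have posN: "pos t < N" if "t < length \<sigma>" for t
  proof -
    have "pos t \<le> (\<Sum>t<length \<sigma>. pos t)" using that by (intro member_le_sum) auto
    then show ?thesis using le_prod_encode_2[of K "bits_encode \<rho>"] by (simp add: N_def K_def)
  qed
  have pos: "node_position (nth_or_0 (initial x N)) (\<lambda>i. of_bool (\<sigma> ! i)) t = pos t"
    if "t < length \<sigma>" for t
    unfolding pos_def using that posN
    by (intro node_position_agree[of N]) (auto simp: nth_or_0_initial pos_def)
  have "initial x N \<in> compressible_test U a b c m"
    unfolding compressible_test_def mem_Collect_eq length_initial
  proof (rule exI[of _ \<rho>], rule exI[of _ \<sigma>], intro conjI allI impI *)
    show "bits_encode \<rho> = fst (prod_decode N)" by (simp add: N_def)
    fix t assume t: "t < length \<sigma>"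
    show "node_position (nth_or_0 (initial x N)) (\<lambda>i. of_bool (\<sigma> ! i)) t < N"
      using posN pos t by simp
    show "permits (nth_or_0 (initial x N)
        (node_position (nth_or_0 (initial x N)) (\<lambda>i. of_bool (\<sigma> ! i)) t)) (\<sigma> ! t)"
      using t \<sigma> posN[OF t] unfolding pos[OF t] nth_or_0_initial[OF posN[OF t]] initial_in_tree_iff
      by (simp add: pos_def)
  qed
  then show "x \<in> cylinders (compressible_test U a b c m)"
    unfolding cylinders_def by blast
qed

section \<open>The distribution of the random tree\<close>

text \<open>The map \<open>f\<close> allows constraints to be indexed by edges or by places in a
  code although they concern the labels of nodes. Injectivity means that no two constraints share a
  coordinate, hence the product.\<close>

lemma measure_iid_Collect:
  fixes D :: "'a pmf" and f :: "'j \<Rightarrow> 'i"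
  assumes "finite K" "inj_on f K"
  shows "measure (\<Pi>\<^sub>M i\<in>UNIV. measure_pmf D) {x. \<forall>j\<in>K. x (f j) \<in> X j} =
    (\<Prod>j\<in>K. measure (measure_pmf D) (X j))"
proof -
  interpret product_prob_space "\<lambda>_::'i. measure_pmf D" UNIV by unfold_locales
  let ?X = "\<lambda>i. X (inv_into K f i)"
  have "{x. \<forall>j\<in>K. x (f j) \<in> X j} = prod_emb UNIV (\<lambda>_. measure_pmf D) (f ` K) (Pi\<^sub>E (f ` K) ?X)"
    using assms(2) by (auto simp: prod_emb_def PiE_iff)
  then have "measure (\<Pi>\<^sub>M i\<in>UNIV. measure_pmf D) {x. \<forall>j\<in>K. x (f j) \<in> X j} =
      (\<Prod>i\<in>f ` K. measure (measure_pmf D) (?X i))"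
    using assms(1) by (simp add: measure_PiM_emb)
  also have "\<dots> = (\<Prod>j\<in>K. measure (measure_pmf D) (X j))"
    using assms(2) by (simp add: prod.reindex)
  finally show ?thesis .
qed

lemma space_bernoulli3 [simp]: "space (bernoulli3 p) = UNIV"
  by (simp add: bernoulli3_def space_PiM)

lemma sets_bernoulli3 [measurable_cong]:
  "sets (bernoulli3 p) = sets (\<Pi>\<^sub>M i\<in>UNIV. count_space UNIV)"
  unfolding bernoulli3_def by (intro sets_PiM_cong) auto

lemma prob_space_bernoulli3: "prob_space (bernoulli3 p)"
  unfolding bernoulli3_def by (intro prob_space_PiM measure_pmf.prob_space_axioms)

lemma measurable_initial [measurable]:
  "(\<lambda>x::nat \<Rightarrow> nat. initial x k) \<in> measurable (\<Pi>\<^sub>M i\<in>UNIV. count_space UNIV) (count_space UNIV)"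
proof (subst measurable_count_space_eq2_countable, intro conjI ballI)
  fix w :: "nat list"
  have "Measurable.pred (\<Pi>\<^sub>M i\<in>UNIV. count_space UNIV) (\<lambda>x. length w = k \<and> (\<forall>j<length w. x j = w ! j))"
    by measurable
  moreover have "(initial x k = w) \<longleftrightarrow> length w = k \<and> (\<forall>j<length w. x j = w ! j)" for x
    using initial_eq_iff[of x w] length_initial[of x k] by metis
  ultimately show "(\<lambda>x. initial x k) -` {w} \<inter> space (\<Pi>\<^sub>M i\<in>UNIV. count_space UNIV)
      \<in> sets (\<Pi>\<^sub>M i\<in>UNIV. count_space UNIV)"
    unfolding pred_def by (simp add: vimage_def space_PiM)
qed simp_all

lemma Collect_in_sets_bernoulli3:
  "Measurable.pred (\<Pi>\<^sub>M i\<in>UNIV. count_space UNIV) P \<Longrightarrow> {x. P x} \<in> sets (bernoulli3 p)"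
  unfolding pred_def sets_bernoulli3 by (simp add: space_PiM)

lemma measure_cylinder:
  "measure (bernoulli3 p) {x. initial x (length w) = w} =
    (\<Prod>j<length w. pmf (pmf_of_list [(0, p), (1, p), (2, 1 - 2 * p)]) (w ! j))"
proof -
  have "{x. initial x (length w) = w} = {x. \<forall>j\<in>{..<length w}. x j \<in> {w ! j}}"
    by (intro Collect_cong) (simp only: initial_eq_iff singleton_iff lessThan_iff Ball_def)
  moreover have "measure (bernoulli3 p) {x. \<forall>j\<in>{..<length w}. x j \<in> {w ! j}} =
      (\<Prod>j\<in>{..<length w}. measure (pmf_of_list [(0, p), (1, p), (2, 1 - 2 * p)]) {w ! j})"
    unfolding bernoulli3_def by (rule measure_iid_Collect[where f = "\<lambda>j. j"]) auto
  ultimately show ?thesis by (simp add: measure_pmf_single)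
qed

text \<open>Finitely many coordinates lie within one initial segment, and there are only countably
  many words. The probabilities of words thus determine all finite-dimensional distributions, and
  with them the measure.\<close>

lemma eq_bernoulli3I:
  assumes "prob_space M" and sets: "sets M = sets (bernoulli3 p)"
    and eq: "\<And>w. measure M {x. initial x (length w) = w} =
      measure (bernoulli3 p) {x. initial x (length w) = w}"
  shows "M = bernoulli3 p"
proof -
  interpret M: prob_space M by fact
  interpret B: prob_space "bernoulli3 p" by (rule prob_space_bernoulli3)
  let ?D = "measure_pmf (pmf_of_list [(0, p), (1, p), (2, 1 - 2 * p)])"
  interpret product_prob_space "\<lambda>_::nat. ?D" UNIV by unfold_locales
  note [measurable_cong] = sets[unfolded sets_bernoulli3]
  have space: "space M = UNIV" using sets_eq_imp_space_eq[OF sets] by simp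
  have distr: "distr M (count_space UNIV) (\<lambda>x. initial x k) =
      distr (bernoulli3 p) (count_space UNIV) (\<lambda>x. initial x k)" for k
  proof (rule measure_eqI_countable[where A = UNIV])
    fix w :: "nat list"
    have "emeasure M {x. initial x k = w} = emeasure (bernoulli3 p) {x. initial x k = w}"
    proof (cases "length w = k")
      case True
      then show ?thesis using eq[of w] by (simp add: M.emeasure_eq_measure B.emeasure_eq_measure)
    next
      case False
      then have "{x. initial x k = w} = {}" using length_initial by blast
      then show ?thesis by simp
    qed
    then show "emeasure (distr M (count_space UNIV) (\<lambda>x. initial x k)) {w} =
        emeasure (distr (bernoulli3 p) (count_space UNIV) (\<lambda>x. initial x k)) {w}"
      by (subst (1 2) emeasure_distr) (auto simp: space vimage_def)
  qed auto
  have "M = PiM UNIV (\<lambda>_. ?D)"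
  proof (rule PiM_eq)
    show "sets M = sets (PiM UNIV (\<lambda>_. ?D))" using sets by (simp add: bernoulli3_def)
    fix J :: "nat set" and F :: "nat \<Rightarrow> nat set" assume J: "finite J"
    obtain k where k: "J \<subseteq> {..<k}" using finite_nat_iff_bounded J by blast
    let ?E = "prod_emb UNIV (\<lambda>_. ?D) J (Pi\<^sub>E J F)"
    let ?S = "{w. \<forall>j\<in>J. w ! j \<in> F j}"
    have nth: "initial x k ! j = x j" if "j \<in> J" for x :: "nat \<Rightarrow> nat" and j
      using k that by auto
    have E: "?E = (\<lambda>x. initial x k) -` ?S"
      by (auto simp: prod_emb_def PiE_iff nth)
    have "emeasure M ?E = emeasure (distr M (count_space UNIV) (\<lambda>x. initial x k)) ?S"
      unfolding E by (subst emeasure_distr) (auto simp: space)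
    also have "\<dots> = emeasure (bernoulli3 p) ?E"
      unfolding distr E by (subst emeasure_distr) auto
    also have "\<dots> = (\<Prod>j\<in>J. emeasure ?D (F j))"
      unfolding bernoulli3_def by (rule emeasure_PiM_emb) (use J in auto)
    finally show "emeasure M ?E = (\<Prod>j\<in>J. emeasure ?D (F j))" .
  qed
  then show ?thesis by (simp add: bernoulli3_def)
qed

text \<open>A digit attached to every finite binary word determines a tree, whose code reads off the
  digits in the order in which the nodes are reached.  Independent digits give a Bernoulli
  distributed code, since the nodes reached are distinct.\<close>

definition label_nodes :: "(bool list \<Rightarrow> nat) \<Rightarrow> nat \<Rightarrow> bool list list" where
  "label_nodes l = rec_nat [[]] (\<lambda>i ns. ns @ successors (l (ns ! i)) (ns ! i))"

definition label_code :: "(bool list \<Rightarrow> nat) \<Rightarrow> nat \<Rightarrow> nat" where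
  "label_code l i = l (label_nodes l i ! i)"

lemma nodes_label_code: "nodes (label_code l) i = label_nodes l i"
  by (induction i) (simp_all add: label_nodes_def label_code_def)

lemma label_code_eq: "label_code l i = l (nodes (label_code l) i ! i)"
  unfolding nodes_label_code by (simp add: label_code_def)

lemma nodes_cong: "(\<And>j. j < i \<Longrightarrow> x j = y j) \<Longrightarrow> nodes x i = nodes y i"
  by (induction i) auto

text \<open>Which labels are read depends on the labels themselves, but on the event that the code
  begins with \<open>w\<close> the nodes reached are those dictated by \<open>w\<close>. The event
  is therefore a condition on fixed coordinates.\<close>

lemma initial_label_code_iff:
  "initial (label_code l) (length w) = w \<longleftrightarrow> (\<forall>j<length w. l (nodes ((!) w) j ! j) = w ! j)"
proof -
  have "(\<forall>j<k. label_code l j = w ! j) \<longleftrightarrow> (\<forall>j<k. l (nodes ((!) w) j ! j) = w ! j)" for k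
  proof (induction k)
    case (Suc k)
    have "label_code l k = l (nodes ((!) w) k ! k)" if "\<forall>j<k. label_code l j = w ! j"
      using label_code_eq[of l k] nodes_cong[of k "label_code l" "(!) w"] that by simp
    with Suc show ?case by (auto simp: less_Suc_eq)
  qed simp
  then show ?thesis unfolding initial_eq_iff .
qed

lemma tree_label_code_snoc:
  "\<sigma> @ [b] \<in> tree (label_code l) \<longleftrightarrow> \<sigma> \<in> tree (label_code l) \<and> permits (l \<sigma>) b"
proof (cases "\<sigma> \<in> tree (label_code l)")
  case True
  then obtain k where k: "\<sigma> = nodes (label_code l) k ! k" unfolding tree_node ..
  have "label_code l k = l \<sigma>" unfolding k by (rule label_code_eq)
  then have "\<sigma> @ [b] \<in> tree (label_code l) \<longleftrightarrow> permits (l \<sigma>) b"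
    using tree_child_iff[of "label_code l" k b] unfolding k[symmetric] by simp
  with True show ?thesis by blast
next
  case False
  then show ?thesis using tree_prefix[of \<sigma> b] by metis
qed

text \<open>A nonempty prefix stands for the edge that enters it from its \<open>butlast\<close>.
  Edges shared by two words are counted once in a union, which gives the exponent in joint
  probabilities.\<close>

primrec edges :: "bool list \<Rightarrow> bool list set" where
  "edges [] = {}"
| "edges (b # \<sigma>) = insert [b] ((#) b ` edges \<sigma>)"

lemma edges_snoc: "edges (\<sigma> @ [b]) = insert (\<sigma> @ [b]) (edges \<sigma>)"
  by (induction \<sigma>) auto

lemma finite_edges [simp]: "finite (edges \<sigma>)"
  by (induction \<sigma>) auto

lemma Nil_notin_edges [simp]: "[] \<notin> edges \<sigma>"
  by (cases \<sigma>) auto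

lemma card_edges: "card (edges \<sigma>) = length \<sigma>"
  by (induction \<sigma>) (auto simp: card_insert_if card_image inj_on_def)

lemma length_le_of_edge: "\<rho> \<in> edges \<sigma> \<Longrightarrow> length \<rho> \<le> length \<sigma>"
  by (induction \<sigma> arbitrary: \<rho>) auto

text \<open>A single path leaves each node by one edge only, so the conditions for a word to be in
  the tree concern distinct labels and are independent.\<close>

lemma inj_on_butlast_edges: "inj_on butlast (edges \<sigma>)"
proof (induction \<sigma> rule: rev_induct)
  case (snoc b \<sigma>)
  have "butlast \<rho> \<noteq> \<sigma>" if "\<rho> \<in> edges \<sigma>" for \<rho>
  proof
    assume "butlast \<rho> = \<sigma>"
    then have "length \<sigma> = length \<rho> - 1" using length_butlast[of \<rho>] by simp
    moreover have "\<rho> \<noteq> []" using that by (metis Nil_notin_edges)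
    ultimately show False using length_le_of_edge[OF that] by (cases \<rho>) auto
  qed
  with snoc show ?case by (auto simp: edges_snoc inj_on_insert)
qed simp

lemma in_tree_label_code_iff:
  "\<sigma> \<in> tree (label_code l) \<longleftrightarrow> (\<forall>\<rho>\<in>edges \<sigma>. permits (l (butlast \<rho>)) (last \<rho>))"
  by (induction \<sigma> rule: rev_induct) (auto simp: tree_iff[of "[]"] tree_label_code_snoc edges_snoc)

locale bernoulli_tree =
  fixes p :: real
  assumes p_nonneg: "0 \<le> p" and p_le_half: "p \<le> 1/2"
begin

definition digit :: "nat pmf" where
  "digit = pmf_of_list [(0, p), (1, p), (2, 1 - 2 * p)]"

definition labels :: "(bool list \<Rightarrow> nat) measure" where
  "labels = (\<Pi>\<^sub>M i\<in>UNIV. measure_pmf digit)"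

lemma measure_digit:
  "measure (measure_pmf digit) X =
    (if 0 \<in> X then p else 0) + (if 1 \<in> X then p else 0) + (if 2 \<in> X then 1 - 2 * p else 0)"
proof -
  have "pmf_of_list_wf [(0::nat, p), (1, p), (2, 1 - 2 * p)]"
    using p_nonneg p_le_half by (auto simp: pmf_of_list_wf_def)
  from measure_pmf_of_list[OF this, of X] show ?thesis by (simp add: digit_def)
qed

lemma measure_permits: "measure (measure_pmf digit) {a. permits a b} = 1 - p"
  unfolding measure_digit by (cases b) (auto simp: permits_def)

lemma space_labels [simp]: "space labels = UNIV"
  by (simp add: labels_def space_PiM)

lemma sets_labels [measurable_cong]: "sets labels = sets (\<Pi>\<^sub>M i\<in>UNIV. count_space UNIV)"
  unfolding labels_def by (intro sets_PiM_cong) auto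

lemma prob_space_labels: "prob_space labels"
  unfolding labels_def by (intro prob_space_PiM measure_pmf.prob_space_axioms)

lemma measurable_label_code [measurable]: "label_code \<in> measurable labels (bernoulli3 p)"
proof -
  have [measurable]: "Measurable.pred labels (\<lambda>l. initial (label_code l) (length w) = w)" for w
    unfolding initial_label_code_iff by measurable
  have "(\<lambda>l. label_code l i) \<in> measurable labels (count_space UNIV)" for i
  proof (subst measurable_count_space_eq2_countable, intro conjI ballI)
    fix a :: nat
    have "label_code l i = a \<longleftrightarrow>
        (\<exists>w. length w = Suc i \<and> w ! i = a \<and> initial (label_code l) (length w) = w)" for l
      by (auto intro!: exI[of _ "initial (label_code l) (Suc i)"] simp: initial_eq_iff)
    moreover have "Measurable.pred labels
        (\<lambda>l. \<exists>w. length w = Suc i \<and> w ! i = a \<and> initial (label_code l) (length w) = w)"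
      by measurable
    ultimately show "(\<lambda>l. label_code l i) -` {a} \<inter> space labels \<in> sets labels"
      unfolding pred_def by (simp add: vimage_def)
  qed simp_all
  then have "label_code \<in> measurable labels (\<Pi>\<^sub>M i\<in>UNIV. count_space UNIV)"
    by (intro measurable_PiM_single') (auto simp: space_PiM)
  then show ?thesis by (simp cong: measurable_cong_sets add: sets_bernoulli3)
qed

lemma distr_label_code: "distr labels (bernoulli3 p) label_code = bernoulli3 p"
proof (rule eq_bernoulli3I)
  show "prob_space (distr labels (bernoulli3 p) label_code)"
    by (intro prob_space.prob_space_distr prob_space_labels) measurable
  fix w :: "nat list"
  have "inj_on (\<lambda>j. nodes ((!) w) j ! j) {..<length w}"
    by (auto simp: inj_on_def dest: node_inj)
  moreover have "{l. initial (label_code l) (length w) = w} =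
      {l. \<forall>j\<in>{..<length w}. l (nodes ((!) w) j ! j) \<in> {w ! j}}"
    by (simp only: initial_label_code_iff Ball_def lessThan_iff singleton_iff)
  ultimately have "measure labels {l. initial (label_code l) (length w) = w} =
      (\<Prod>j<length w. measure (measure_pmf digit) {w ! j})"
    unfolding labels_def
    using measure_iid_Collect[of "{..<length w}" "\<lambda>j. nodes ((!) w) j ! j" digit "\<lambda>j. {w ! j}"]
    by simp
  also have "\<dots> = measure (bernoulli3 p) {x. initial x (length w) = w}"
    by (simp add: measure_cylinder measure_pmf_single digit_def)
  finally show "measure (distr labels (bernoulli3 p) label_code) {x. initial x (length w) = w} =
      measure (bernoulli3 p) {x. initial x (length w) = w}"
    by (subst measure_distr) (auto simp: vimage_def intro!: Collect_in_sets_bernoulli3)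
qed simp

end

text \<open>The first \<open>i\<close> digits determine \<open>nodes x i\<close>, so membership is a
  countable union of conditions on initial segments.\<close>

lemma pred_in_tree [measurable]:
  "Measurable.pred (\<Pi>\<^sub>M i\<in>UNIV. count_space UNIV) (\<lambda>x. \<sigma> \<in> tree x)"
proof -
  have "\<sigma> \<in> tree x \<longleftrightarrow> (\<exists>i. \<sigma> \<in> set (nodes ((!) (initial x i)) i))" for x
  proof -
    have "nodes ((!) (initial x i)) i = nodes x i" for i by (rule nodes_cong) simp
    then show ?thesis by (simp add: tree_def)
  qed
  moreover have "Measurable.pred (\<Pi>\<^sub>M i\<in>UNIV. count_space UNIV)
      (\<lambda>x. \<exists>i. \<sigma> \<in> set (nodes ((!) (initial x i)) i))"
    by (intro pred_intros_countable measurable_compose[OF measurable_initial]) simp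
  ultimately show ?thesis by simp
qed

context bernoulli_tree
begin

lemma measure_tree_eq_labels:
  assumes "finite S"
  shows "measure (bernoulli3 p) {x. \<forall>\<sigma>\<in>S. \<sigma> \<in> tree x} =
    measure labels {l. \<forall>\<rho>\<in>\<Union>(edges ` S). permits (l (butlast \<rho>)) (last \<rho>)}"
proof -
  have "measure (bernoulli3 p) {x. \<forall>\<sigma>\<in>S. \<sigma> \<in> tree x} =
      measure (distr labels (bernoulli3 p) label_code) {x. \<forall>\<sigma>\<in>S. \<sigma> \<in> tree x}"
    by (simp add: distr_label_code)
  also have "\<dots> = measure labels {l. \<forall>\<sigma>\<in>S. \<sigma> \<in> tree (label_code l)}"
    using assms by (subst measure_distr) (auto simp: vimage_def intro!: Collect_in_sets_bernoulli3)
  also have "\<dots> = measure labels {l. \<forall>\<rho>\<in>\<Union>(edges ` S). permits (l (butlast \<rho>)) (last \<rho>)}"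
    by (simp add: in_tree_label_code_iff)
  finally show ?thesis .
qed

lemma measure_in_tree: "measure (bernoulli3 p) {x. \<sigma> \<in> tree x} = (1 - p) ^ length \<sigma>"
  using measure_tree_eq_labels[of "{\<sigma>}"]
    measure_iid_Collect[of "edges \<sigma>" butlast digit "\<lambda>\<rho>. {a. permits a (last \<rho>)}"]
  by (simp add: labels_def inj_on_butlast_edges measure_permits card_edges)

text \<open>Grouping the edges by parent makes the groups independent. A single edge contributes the
  factor 1 - p; two sibling edges contribute 1 - 2 p = (1 - p)^2 - p^2. The negative correlation of
  siblings is the only source of the inequality.\<close>

lemma measure_all_permits_le:
  assumes "finite E" "[] \<notin> E"
  shows "measure labels {l. \<forall>\<rho>\<in>E. permits (l (butlast \<rho>)) (last \<rho>)} \<le> (1 - p) ^ card E"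
proof -
  let ?F = "\<lambda>\<sigma>. {\<rho>\<in>E. butlast \<rho> = \<sigma>}"
  have F: "?F \<sigma> \<subseteq> {\<sigma> @ [False], \<sigma> @ [True]}" for \<sigma>
  proof
    fix \<rho> assume "\<rho> \<in> ?F \<sigma>"
    then have "\<rho> = \<sigma> @ [last \<rho>]" using assms(2) append_butlast_last_id[of \<rho>] by fastforce
    then show "\<rho> \<in> {\<sigma> @ [False], \<sigma> @ [True]}" by (cases "last \<rho>") auto
  qed
  have le: "measure (measure_pmf digit) {a. \<forall>\<rho>\<in>S. permits a (last \<rho>)} \<le> (1 - p) ^ card S"
    if S: "S \<subseteq> {\<sigma> @ [False], \<sigma> @ [True]}" for S \<sigma>
  proof -
    have square: "1 - 2 * p \<le> (1 - p)\<^sup>2" by (simp add: power2_eq_square algebra_simps)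
    from S consider "S = {}" | "S = {\<sigma> @ [False]}" | "S = {\<sigma> @ [True]}" |
      "S = {\<sigma> @ [False], \<sigma> @ [True]}" by blast
    then show ?thesis
      unfolding measure_digit using square
      by cases (simp_all add: permits_def power2_eq_square)
  qed
  have "{l. \<forall>\<rho>\<in>E. permits (l (butlast \<rho>)) (last \<rho>)} =
      {l. \<forall>\<sigma>\<in>butlast ` E. l \<sigma> \<in> {a. \<forall>\<rho>\<in>?F \<sigma>. permits a (last \<rho>)}}" by auto
  then have "measure labels {l. \<forall>\<rho>\<in>E. permits (l (butlast \<rho>)) (last \<rho>)} =
      (\<Prod>\<sigma>\<in>butlast ` E. measure (measure_pmf digit) {a. \<forall>\<rho>\<in>?F \<sigma>. permits a (last \<rho>)})"
    using measure_iid_Collect[of "butlast ` E" "\<lambda>\<sigma>. \<sigma>" digit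
        "\<lambda>\<sigma>. {a. \<forall>\<rho>\<in>?F \<sigma>. permits a (last \<rho>)}"] assms(1)
    by (simp add: labels_def)
  also have "\<dots> \<le> (\<Prod>\<sigma>\<in>butlast ` E. (1 - p) ^ card (?F \<sigma>))"
    by (intro prod_mono conjI le[OF F] measure_nonneg)
  also have "\<dots> = (1 - p) ^ (\<Sum>\<sigma>\<in>butlast ` E. card (?F \<sigma>))"
    by (simp add: power_sum)
  also have "(\<Sum>\<sigma>\<in>butlast ` E. card (?F \<sigma>)) = card E"
    using sum.image_gen[OF assms(1), of "\<lambda>_. 1::nat" butlast] by simp
  finally show ?thesis .
qed

lemma measure_two_in_tree_le:
  "measure (bernoulli3 p) {x. \<sigma> \<in> tree x \<and> \<tau> \<in> tree x} \<le> (1 - p) ^ card (edges \<sigma> \<union> edges \<tau>)"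
  using measure_tree_eq_labels[of "{\<sigma>, \<tau>}"] measure_all_permits_le[of "edges \<sigma> \<union> edges \<tau>"]
  by simp

end

section \<open>Almost all tuples are mutually random\<close>

text \<open>Every test relative to an oracle is given by a program. Countability of programs allows
  the null sets of all tests to be united.\<close>

instance recf :: countable
  by countable_datatype

inductive_simps computes_Zero_iff: "computes A Zero xs y"
inductive_simps computes_Succ_iff: "computes A Succ xs y"
inductive_simps computes_Proj_iff: "computes A (Proj i) xs y"
inductive_simps computes_Query_iff: "computes A Query xs y"
inductive_simps computes_Comp_iff: "computes A (Comp f gs) xs y"
inductive_simps computes_PrimRec_iff:
  "computes A (PrimRec f g) [] y"
  "computes A (PrimRec f g) (0 # xs) y"
  "computes A (PrimRec f g) (Suc m # xs) y"
inductive_simps computes_Minim_iff: "computes A (Minim f) xs y"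

abbreviation seq_space :: "(nat \<Rightarrow> nat) measure" where
  "seq_space \<equiv> \<Pi>\<^sub>M i\<in>UNIV. count_space UNIV"

text \<open>The oracle is itself random, so halting has to be measurable in \<open>A\<close>. For a
  fixed program each evaluation rule only quantifies over countable sets; primitive recursion
  requires an inner induction on its first argument.\<close>

lemma pred_computes [measurable]: "Measurable.pred seq_space (\<lambda>A. computes A e xs y)"
proof (induction e arbitrary: xs y)
  case Zero
  then show ?case unfolding computes_Zero_iff by simp
next
  case Succ
  then show ?case unfolding computes_Succ_iff by simp
next
  case (Proj i)
  then show ?case unfolding computes_Proj_iff by simp
next
  case Query
  then show ?case unfolding computes_Query_iff by measurable
next
  case (Comp f gs)
  have [measurable]: "Measurable.pred seq_space (\<lambda>A. computes A (gs ! i) xs y)"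
    if "i < length gs" for i xs y
    using Comp.IH(2) nth_mem[OF that] by blast
  note [measurable] = Comp.IH(1)
  show ?case unfolding computes_Comp_iff list_all2_conv_all_nth by measurable
next
  case (PrimRec f g)
  note [measurable] = PrimRec.IH
  have "Measurable.pred seq_space (\<lambda>A. computes A (PrimRec f g) (m # xs) y)" for m xs y
  proof (induction m arbitrary: y)
    case 0
    show ?case unfolding computes_PrimRec_iff by measurable
  next
    case (Suc m)
    note [measurable] = this
    show ?case unfolding computes_PrimRec_iff by measurable
  qed
  then show ?case by (cases xs) (simp_all add: computes_PrimRec_iff)
next
  case (Minim f)
  note [measurable] = Minim.IH
  show ?case unfolding computes_Minim_iff by measurable
qed

text \<open>Tests are named by programs: this is membership in the \<open>m\<close>-th open set that
  \<open>e\<close> enumerates relative to \<open>A\<close>.\<close>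

definition covered :: "recf \<Rightarrow> (nat \<Rightarrow> nat) \<Rightarrow> nat \<Rightarrow> (nat \<Rightarrow> nat) \<Rightarrow> bool" where
  "covered e A m x \<longleftrightarrow> (\<exists>r v. computes A e [m, list_encode (initial x r)] v)"

lemma covered_iff:
  "covered e A m x \<longleftrightarrow> (\<exists>w v. initial x (length w) = w \<and> computes A e [m, list_encode w] v)"
  unfolding covered_def by (metis length_initial)

lemma not_random_covered:
  assumes "ternary x" "\<not> martin_loef_random p A x"
  shows "\<exists>e. (\<forall>m. measure (bernoulli3 p) {y. covered e A m y} \<le> (1/2) ^ m) \<and> (\<forall>m. covered e A m x)"
proof -
  obtain W where W: "martin_loef_test p A W" "x \<in> (\<Inter>m. cylinders (W m))"
    using assms unfolding martin_loef_random_def by blast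
  then obtain e where e: "\<And>m \<sigma>. \<sigma> \<in> W m \<longleftrightarrow> (\<exists>y. computes A e [m, list_encode \<sigma>] y)"
    unfolding martin_loef_test_def uniformly_ce_def by blast
  have "covered e A m = (\<lambda>y. y \<in> cylinders (W m))" for m
    by (simp add: covered_def cylinders_def e fun_eq_iff)
  with W show ?thesis
    unfolding martin_loef_test_def by (intro exI[of _ e]) simp
qed

lemma measure_all_covered_eq_0:
  assumes "\<And>m. measure (bernoulli3 p) {y. covered e A m y} \<le> (1/2) ^ m"
  shows "measure (bernoulli3 p) {y. \<forall>m. covered e A m y} = 0"
proof -
  interpret prob_space "bernoulli3 p" by (rule prob_space_bernoulli3)
  have [measurable]: "Measurable.pred seq_space (covered e A m)" for m
    unfolding covered_iff by measurable
  have "measure (bernoulli3 p) {y. \<forall>m. covered e A m y} \<le> (1/2) ^ m" for m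
  proof -
    have "measure (bernoulli3 p) {y. \<forall>m. covered e A m y} \<le> measure (bernoulli3 p) {y. covered e A m y}"
      by (intro finite_measure_mono Collect_in_sets_bernoulli3) auto
    with assms[of m] show ?thesis by simp
  qed
  moreover have "(\<lambda>m. (1/2) ^ m :: real) \<longlonglongrightarrow> 0" by (intro LIMSEQ_power_zero) simp
  ultimately have "measure (bernoulli3 p) {y. \<forall>m. covered e A m y} \<le> 0"
    by (intro LIMSEQ_le_const) auto
  then show ?thesis by (simp add: measure_le_0_iff)
qed

text \<open>With the measure bound built into the relation, its section at every oracle is null:
  either \<open>e\<close> gives a test there, or the section is empty.\<close>

definition captured :: "real \<Rightarrow> recf \<Rightarrow> (nat \<Rightarrow> nat) \<Rightarrow> (nat \<Rightarrow> nat) \<Rightarrow> bool" where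
  "captured p e A x \<longleftrightarrow> (\<forall>m. measure (bernoulli3 p) {y. covered e A m y} \<le> (1/2) ^ m) \<and>
    (\<forall>m. covered e A m x)"

text \<open>The measure bound varies with the oracle; it is measurable because the measures of
  sections of a measurable set are.\<close>

lemma pred_captured [measurable]:
  assumes [measurable]: "f \<in> measurable M seq_space" "g \<in> measurable M seq_space"
  shows "Measurable.pred M (\<lambda>z. captured p e (f z) (g z))"
proof -
  interpret prob_space "bernoulli3 p" by (rule prob_space_bernoulli3)
  have cov: "Measurable.pred M' (\<lambda>z. covered e (f' z) m (g' z))"
    if [measurable]: "f' \<in> measurable M' seq_space" "g' \<in> measurable M' seq_space"
    for M' :: "'z measure" and f' g' m
    unfolding covered_iff by measurable
  have "{z. covered e (fst z) m (snd z)} \<in> sets (seq_space \<Otimes>\<^sub>M bernoulli3 p)" for m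
    using cov[of fst "seq_space \<Otimes>\<^sub>M bernoulli3 p" snd m]
    by (simp add: pred_def space_pair_measure space_PiM)
  from measurable_emeasure_Pair[OF this]
  have "(\<lambda>A. emeasure (bernoulli3 p) {y. covered e A m y}) \<in> borel_measurable seq_space" for m
    by (simp add: vimage_def)
  then have [measurable]: "(\<lambda>A. measure (bernoulli3 p) {y. covered e A m y}) \<in> borel_measurable seq_space"
    for m
    unfolding measure_def by measurable
  note cov[measurable]
  show ?thesis unfolding captured_def by measurable
qed

lemma AE_ternary: "AE x in bernoulli3 p. ternary x" if "0 \<le> p" "p \<le> 1/2"
proof -
  let ?D = "pmf_of_list [(0::nat, p), (1, p), (2, 1 - 2 * p)]"
  have "pmf_of_list_wf [(0::nat, p), (1, p), (2, 1 - 2 * p)]"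
    using that by (auto simp: pmf_of_list_wf_def)
  from set_pmf_of_list[OF this] have "set_pmf ?D \<subseteq> {..<3}" by auto
  then have "AE a in measure_pmf ?D. a < 3" by (auto simp: AE_measure_pmf_iff)
  then have "AE x in bernoulli3 p. x i < 3" for i
    unfolding bernoulli3_def by (intro AE_PiM_component measure_pmf.prob_space_axioms) auto
  then show ?thesis unfolding ternary_def by (simp add: AE_all_countable)
qed

text \<open>The premise \<open>indep\<close> says that the oracle ignores coordinate
  \<open>i\<close>. Splitting this coordinate off leaves, for each value of the others, a fixed
  oracle and a null set of captured sequences.\<close>

lemma AE_random_rel:
  fixes g :: "('i \<Rightarrow> nat \<Rightarrow> nat) \<Rightarrow> nat \<Rightarrow> nat"
  assumes p: "0 \<le> p" "p \<le> 1/2" and i: "i \<in> I"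
    and g [measurable]: "g \<in> measurable (\<Pi>\<^sub>M j\<in>I. bernoulli3 p) seq_space"
    and indep: "\<And>X x. g (X(i := x)) = g X"
  shows "AE \<omega> in (\<Pi>\<^sub>M j\<in>I. bernoulli3 p). martin_loef_random p (g \<omega>) (\<omega> i)"
proof -
  let ?B = "bernoulli3 p"
  let ?I = "I - {i}"
  interpret B: prob_space ?B by (rule prob_space_bernoulli3)
  interpret R: prob_space "\<Pi>\<^sub>M j\<in>?I. ?B" by (intro prob_space_PiM prob_space_bernoulli3)
  interpret pair_sigma_finite ?B "\<Pi>\<^sub>M j\<in>?I. ?B" by unfold_locales
  have I: "insert i ?I = I" using i by auto
  have upd [measurable]: "(\<lambda>(x, X). X(i := x)) \<in>
      measurable (?B \<Otimes>\<^sub>M (\<Pi>\<^sub>M j\<in>?I. ?B)) (\<Pi>\<^sub>M j\<in>I. ?B)"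
    unfolding split_beta by (rule measurable_fun_upd[of I ?I i]) (use i in auto)
  have comp [measurable]: "(\<lambda>\<omega>. \<omega> i) \<in> measurable (\<Pi>\<^sub>M j\<in>I. ?B) seq_space"
    using measurable_component_singleton[OF i, of "\<lambda>_. ?B"]
    by (simp cong: measurable_cong_sets add: sets_bernoulli3)
  have "AE \<omega> in (\<Pi>\<^sub>M j\<in>I. ?B). \<not> captured p e (g \<omega>) (\<omega> i)" for e
  proof -
    have "{z. captured p e (g (snd z)) (fst z)} \<inter> space (?B \<Otimes>\<^sub>M (\<Pi>\<^sub>M j\<in>?I. ?B))
        \<in> sets (?B \<Otimes>\<^sub>M (\<Pi>\<^sub>M j\<in>?I. ?B))" (is "?Q \<in> _")
    proof -
      have "Measurable.pred (?B \<Otimes>\<^sub>M (\<Pi>\<^sub>M j\<in>?I. ?B))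
          (\<lambda>z. captured p e (g (case z of (x, X) \<Rightarrow> X(i := x))) ((case z of (x, X) \<Rightarrow> X(i := x)) i))"
        by measurable
      then show ?thesis
        by (simp add: pred_def indep split_beta Int_def conj_commute)
    qed
    then have "emeasure (?B \<Otimes>\<^sub>M (\<Pi>\<^sub>M j\<in>?I. ?B)) ?Q =
        (\<integral>\<^sup>+X. emeasure ?B ((\<lambda>x. (x, X)) -` ?Q) \<partial>(\<Pi>\<^sub>M j\<in>?I. ?B))"
      by (rule emeasure_pair_measure_alt2)
    also have "\<dots> = (\<integral>\<^sup>+X. 0 \<partial>(\<Pi>\<^sub>M j\<in>?I. ?B))"
    proof (rule nn_integral_cong)
      fix X assume X: "X \<in> space (\<Pi>\<^sub>M j\<in>?I. ?B)"
      then have "(\<lambda>x. (x, X)) -` ?Q = {x. captured p e (g X) x}"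
        by (auto simp: space_pair_measure)
      also have "measure ?B \<dots> = 0"
      proof (cases "\<forall>m. measure ?B {y. covered e (g X) m y} \<le> (1/2) ^ m")
        case True
        then show ?thesis
          using measure_all_covered_eq_0[of p e "g X"] by (simp add: captured_def)
      next
        case False
        then have "{x. captured p e (g X) x} = {}" unfolding captured_def by blast
        then show ?thesis by simp
      qed
      finally show "emeasure ?B ((\<lambda>x. (x, X)) -` ?Q) = 0"
        by (simp add: B.emeasure_eq_measure)
    qed
    finally have "emeasure (?B \<Otimes>\<^sub>M (\<Pi>\<^sub>M j\<in>?I. ?B)) ?Q = 0" by simp
    then have "AE z in ?B \<Otimes>\<^sub>M (\<Pi>\<^sub>M j\<in>?I. ?B).
        \<not> captured p e (g (case z of (x, X) \<Rightarrow> X(i := x))) ((case z of (x, X) \<Rightarrow> X(i := x)) i)"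
      using \<open>?Q \<in> _\<close> by (intro AE_I[of _ _ ?Q]) (auto simp: indep)
    then have "AE \<omega> in distr (?B \<Otimes>\<^sub>M (\<Pi>\<^sub>M j\<in>?I. ?B)) (\<Pi>\<^sub>M j\<in>I. ?B) (\<lambda>(x, X). X(i := x)).
        \<not> captured p e (g \<omega>) (\<omega> i)"
      by (subst AE_distr_iff) measurable
    also have "distr (?B \<Otimes>\<^sub>M (\<Pi>\<^sub>M j\<in>?I. ?B)) (\<Pi>\<^sub>M j\<in>I. ?B) (\<lambda>(x, X). X(i := x)) =
        (\<Pi>\<^sub>M j\<in>I. ?B)"
      using distr_pair_PiM_eq_PiM[of ?I "\<lambda>_. ?B" i] prob_space_bernoulli3 unfolding I by blast
    finally show ?thesis .
  qed
  then have "AE \<omega> in (\<Pi>\<^sub>M j\<in>I. ?B). \<forall>e. \<not> captured p e (g \<omega>) (\<omega> i)"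
    by (simp add: AE_all_countable)
  moreover have "AE \<omega> in (\<Pi>\<^sub>M j\<in>I. ?B). ternary (\<omega> i)"
    using p i by (intro AE_PiM_component prob_space_bernoulli3 AE_ternary)
  ultimately show ?thesis
    by eventually_elim (use not_random_covered in \<open>unfold captured_def, blast\<close>)
qed

section \<open>Survival of the intersection\<close>

text \<open>With N the number of events that occur, 2 t N - (t N)^2 \<le> 1 everywhere, and the left
  side vanishes where N = 0; taking expectations gives the claim. Optimizing t would give (E N)^2 /
  E (N^2), while the free parameter permits the use of a mere upper bound for the second
  moment.\<close>

lemma (in prob_space) second_moment_bound:
  fixes t :: real
  assumes "finite S" and A [measurable]: "\<And>s. s \<in> S \<Longrightarrow> A s \<in> events"
  shows "2 * t * (\<Sum>s\<in>S. prob (A s)) - t\<^sup>2 * (\<Sum>s\<in>S. \<Sum>s'\<in>S. prob (A s \<inter> A s'))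
    \<le> prob (\<Union>s\<in>S. A s)"
proof -
  define N :: "'a \<Rightarrow> real" where "N x = (\<Sum>s\<in>S. indicator (A s) x)" for x
  have sq: "(\<Sum>s\<in>S. \<Sum>s'\<in>S. indicator (A s \<inter> A s') x) = (N x)\<^sup>2" for x
    by (simp add: N_def power2_eq_square sum_product indicator_inter_arith)
  have U: "(\<Union>s\<in>S. A s) \<in> events" using assms by (intro sets.finite_UN) auto
  have int: "integrable M (indicator B :: 'a \<Rightarrow> real)" if "B \<in> events" for B
    using that by (simp add: integrable_indicator_iff emeasure_eq_measure)
  have le: "2 * t * N x - t\<^sup>2 * (\<Sum>s\<in>S. \<Sum>s'\<in>S. indicator (A s \<inter> A s') x)
      \<le> (indicator (\<Union>s\<in>S. A s) x :: real)" for x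
  proof (cases "x \<in> (\<Union>s\<in>S. A s)")
    case True
    have "0 \<le> (t * N x - 1)\<^sup>2" by simp
    with True show ?thesis unfolding sq by (simp add: power2_eq_square algebra_simps)
  next
    case False
    then have "N x = 0" unfolding N_def by (intro sum.neutral) auto
    with False show ?thesis unfolding sq by simp
  qed
  have "2 * t * (\<Sum>s\<in>S. prob (A s)) - t\<^sup>2 * (\<Sum>s\<in>S. \<Sum>s'\<in>S. prob (A s \<inter> A s')) =
      (\<integral>x. 2 * t * N x - t\<^sup>2 * (\<Sum>s\<in>S. \<Sum>s'\<in>S. indicator (A s \<inter> A s') x) \<partial>M)"
    unfolding N_def
    by (subst Bochner_Integration.integral_diff)
      (auto simp: Bochner_Integration.integral_sum int A sets.Int intro!: Bochner_Integration.integrable_sum)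
  also have "\<dots> \<le> (\<integral>x. indicator (\<Union>s\<in>S. A s) x \<partial>M)"
    unfolding N_def
    by (intro integral_mono le[unfolded N_def])
      (auto intro!: Bochner_Integration.integrable_sum Bochner_Integration.integrable_diff int A U)
  also have "\<dots> = prob (\<Union>s\<in>S. A s)" using U by simp
  finally show ?thesis .
qed

section \<open>Counting pairs of words by their distinct edges\<close>

definition words :: "nat \<Rightarrow> bool list set" where
  "words r = {\<sigma>. length \<sigma> = r}"

lemma words_0: "words 0 = {[]}"
  by (simp add: words_def)

lemma words_Suc: "words (Suc r) = (#) True ` words r \<union> (#) False ` words r"
proof -
  have "\<sigma> \<in> (#) True ` words r \<union> (#) False ` words r" if "length \<sigma> = Suc r" for \<sigma>
  proof -
    obtain b \<tau> where "\<sigma> = b # \<tau>" "length \<tau> = r" using \<open>length \<sigma> = Suc r\<close> by (cases \<sigma>) auto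
    then show ?thesis by (cases b) (auto simp: words_def)
  qed
  then show ?thesis by (auto simp: words_def)
qed

lemma finite_words [simp]: "finite (words r)"
  by (induction r) (simp_all add: words_0 words_Suc)

lemma sum_words_Suc:
  fixes f :: "bool list \<Rightarrow> 'b :: comm_monoid_add"
  shows "sum f (words (Suc r)) = (\<Sum>\<sigma>\<in>words r. f (True # \<sigma>)) + (\<Sum>\<sigma>\<in>words r. f (False # \<sigma>))"
  unfolding words_Suc by (subst sum.union_disjoint) (auto simp: sum.reindex)

lemma card_words: "card (words r) = 2 ^ r"
  using sum_words_Suc[of "\<lambda>_. 1::nat"] by (induction r) (simp_all add: words_0)

lemma card_edges_Cons_same:
  "card (edges (b # \<sigma>) \<union> edges (b # \<tau>)) = Suc (card (edges \<sigma> \<union> edges \<tau>))"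
proof -
  have "edges (b # \<sigma>) \<union> edges (b # \<tau>) = insert [b] ((#) b ` (edges \<sigma> \<union> edges \<tau>))" by auto
  moreover have "[b] \<notin> (#) b ` (edges \<sigma> \<union> edges \<tau>)" by auto
  ultimately show ?thesis by (simp only: card_insert_disjoint finite_imageI finite_Un finite_edges
        card_image inj_on_Cons1 simp_thms)
qed

lemma card_edges_Cons_different:
  assumes "b \<noteq> c"
  shows "card (edges (b # \<sigma>) \<union> edges (c # \<tau>)) = Suc (length \<sigma>) + Suc (length \<tau>)"
proof -
  have "edges (b # \<sigma>) \<inter> edges (c # \<tau>) = {}" using assms by auto
  then have "card (edges (b # \<sigma>) \<union> edges (c # \<tau>)) = card (edges (b # \<sigma>)) + card (edges (c # \<tau>))"
    by (intro card_Un_disjoint finite_edges)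
  then show ?thesis unfolding card_edges by simp
qed

text \<open>The second moment of the number of surviving words of length \<open>r\<close> when every
  edge of the binary tree is kept independently with probability \<theta>.\<close>

definition pair_weight :: "real \<Rightarrow> nat \<Rightarrow> real" where
  "pair_weight \<theta> r = (\<Sum>\<sigma>\<in>words r. \<Sum>\<tau>\<in>words r. \<theta> ^ card (edges \<sigma> \<union> edges \<tau>))"

text \<open>Pairs with the same first letter share one edge and then continue as a pair of length
  \<open>r\<close>. The 2 * 4^r pairs with different first letters share nothing and have weight
  \<theta>^(2 r + 2) each.\<close>

lemma pair_weight_Suc:
  "pair_weight \<theta> (Suc r) = 2 * \<theta> * pair_weight \<theta> r + (2 * \<theta>) ^ (2 * Suc r) / 2"
proof -
  have diff: "(\<Sum>\<sigma>\<in>words r. \<Sum>\<tau>\<in>words r. \<theta> ^ card (edges (b # \<sigma>) \<union> edges (c # \<tau>))) =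
      (2 * \<theta>) ^ (2 * Suc r) / 4" if "b \<noteq> c" for b c
  proof -
    have "(\<Sum>\<sigma>\<in>words r. \<Sum>\<tau>\<in>words r. \<theta> ^ card (edges (b # \<sigma>) \<union> edges (c # \<tau>))) =
        (\<Sum>\<sigma>\<in>words r. \<Sum>\<tau>\<in>words r. \<theta> ^ (2 * Suc r))"
      unfolding card_edges_Cons_different[OF that]
      by (intro sum.cong refl arg_cong[where f = "(^) \<theta>"]) (simp add: words_def)
    also have "\<dots> = 2 ^ (2 * r) * \<theta> ^ (2 * Suc r)"
      by (simp only: sum_constant card_words of_nat_power of_nat_numeral mult_2[of r] power_add
          mult.assoc)
    also have "\<dots> = (2 * \<theta>) ^ (2 * Suc r) / 4"
      by (simp add: power_mult_distrib)
    finally show ?thesis .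
  qed
  have same: "(\<Sum>\<sigma>\<in>words r. \<Sum>\<tau>\<in>words r. \<theta> ^ card (edges (b # \<sigma>) \<union> edges (b # \<tau>))) =
      \<theta> * pair_weight \<theta> r" for b
    unfolding card_edges_Cons_same by (simp add: pair_weight_def sum_distrib_left)
  have "pair_weight \<theta> (Suc r) = \<theta> * pair_weight \<theta> r + (2 * \<theta>) ^ (2 * Suc r) / 4 +
      ((2 * \<theta>) ^ (2 * Suc r) / 4 + \<theta> * pair_weight \<theta> r)"
    unfolding pair_weight_def[of _ "Suc r"] sum_words_Suc sum.distrib same
      diff[OF True_not_False] diff[OF False_not_True] by (rule refl)
  then show ?thesis by simp
qed

text \<open>The start of the induction needs C \<ge> 1, and its step needs C + \<theta> \<le> 2
  \<theta> C, that is, C \<ge> \<theta> / (2 \<theta> - 1). The constant is the sum of the two lower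
  bounds.\<close>

lemma pair_weight_le:
  assumes "2 * \<theta> > 1"
  defines "C \<equiv> 1 + \<theta> / (2 * \<theta> - 1)"
  shows "pair_weight \<theta> r \<le> C * (2 * \<theta>) ^ (2 * r)"
proof (induction r)
  case 0
  have "0 \<le> \<theta> / (2 * \<theta> - 1)" using assms(1) by simp
  then show ?case by (simp add: pair_weight_def words_0 C_def)
next
  case (Suc r)
  have "C * (2 * \<theta> - 1) = 2 * \<theta> - 1 + \<theta>"
    using assms(1) unfolding C_def by (simp add: distrib_right)
  then have C: "C + \<theta> \<le> C * (2 * \<theta>)"
    using assms(1) by (simp add: algebra_simps)
  have "pair_weight \<theta> (Suc r) \<le> 2 * \<theta> * (C * (2 * \<theta>) ^ (2 * r)) + (2 * \<theta>) ^ (2 * Suc r) / 2"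
    unfolding pair_weight_Suc using Suc assms(1) by (intro add_right_mono mult_left_mono) auto
  also have "\<dots> = (C + \<theta>) * (2 * \<theta>) ^ (2 * r + 1)"
    by (simp add: algebra_simps)
  also have "\<dots> \<le> C * (2 * \<theta>) * (2 * \<theta>) ^ (2 * r + 1)"
    using C assms(1) by (intro mult_right_mono) auto
  finally show ?case by simp
qed

section \<open>Common nodes of independent random trees\<close>

definition common_node :: "nat \<Rightarrow> (nat \<Rightarrow> nat \<Rightarrow> nat) \<Rightarrow> bool list \<Rightarrow> bool" where
  "common_node m ys \<sigma> \<longleftrightarrow> (\<forall>j<m. \<sigma> \<in> tree (ys j))"

abbreviation tuple_space :: "real \<Rightarrow> nat \<Rightarrow> (nat \<Rightarrow> nat \<Rightarrow> nat) measure" where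
  "tuple_space p m \<equiv> \<Pi>\<^sub>M j\<in>{..<m}. bernoulli3 p"

lemma prob_space_tuple_space: "prob_space (tuple_space p m)"
  by (intro prob_space_PiM prob_space_bernoulli3)

lemma measurable_tuple_component:
  "j < m \<Longrightarrow> (\<lambda>ys. ys j) \<in> measurable (tuple_space p m) seq_space"
  using measurable_component_singleton[of j "{..<m}" "\<lambda>_. bernoulli3 p"]
  by (simp cong: measurable_cong_sets add: sets_bernoulli3)

lemma pred_common_node [measurable]:
  "Measurable.pred (tuple_space p m) (\<lambda>ys. common_node m ys \<sigma>)"
proof -
  note [measurable] = measurable_tuple_component
  show ?thesis unfolding common_node_def by measurable
qed

lemma measure_tuple_space:
  assumes "X \<in> sets (bernoulli3 p)"
  shows "measure (tuple_space p m) {ys \<in> space (tuple_space p m). \<forall>j<m. ys j \<in> X} =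
    measure (bernoulli3 p) X ^ m"
proof -
  interpret B: prob_space "bernoulli3 p" by (rule prob_space_bernoulli3)
  interpret product_prob_space "\<lambda>_::nat. bernoulli3 p" "{..<m}" by unfold_locales
  have "emeasure (tuple_space p m) {ys \<in> space (tuple_space p m). \<forall>j\<in>{..<m}. ys j \<in> X} =
      ennreal (measure (bernoulli3 p) X ^ m)"
    using assms by (subst emeasure_PiM_Collect) (auto simp: B.emeasure_eq_measure ennreal_power)
  then have "measure (tuple_space p m) {ys \<in> space (tuple_space p m). \<forall>j\<in>{..<m}. ys j \<in> X} =
      measure (bernoulli3 p) X ^ m"
    by (simp add: measure_def)
  then show ?thesis by (simp only: Ball_def lessThan_iff)
qed

context bernoulli_tree
begin

lemma measure_common_node:
  "measure (tuple_space p m) {ys \<in> space (tuple_space p m). common_node m ys \<sigma>} =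
    ((1 - p) ^ m) ^ length \<sigma>"
  using measure_tuple_space[of "{x. \<sigma> \<in> tree x}" p m] Collect_in_sets_bernoulli3[OF pred_in_tree]
  by (simp add: common_node_def measure_in_tree flip: power_mult) (simp add: mult.commute)

lemma measure_two_common_nodes_le:
  "measure (tuple_space p m)
    {ys \<in> space (tuple_space p m). common_node m ys \<sigma> \<and> common_node m ys \<tau>} \<le>
    ((1 - p) ^ m) ^ card (edges \<sigma> \<union> edges \<tau>)"
proof -
  have "{x. \<sigma> \<in> tree x \<and> \<tau> \<in> tree x} \<in> sets (bernoulli3 p)"
    by (intro Collect_in_sets_bernoulli3) measurable
  from measure_tuple_space[OF this, of m]
  have "measure (tuple_space p m)
      {ys \<in> space (tuple_space p m). common_node m ys \<sigma> \<and> common_node m ys \<tau>} =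
      measure (bernoulli3 p) {x. \<sigma> \<in> tree x \<and> \<tau> \<in> tree x} ^ m"
    by (simp add: common_node_def all_conj_distrib[symmetric] imp_conjR)
  also have "\<dots> \<le> ((1 - p) ^ card (edges \<sigma> \<union> edges \<tau>)) ^ m"
    by (intro power_mono measure_two_in_tree_le measure_nonneg)
  finally show ?thesis by (simp add: mult.commute flip: power_mult)
qed

lemma measure_common_level_ge:
  assumes "2 * (1 - p) ^ m > 1"
  shows "measure (tuple_space p m)
      {ys \<in> space (tuple_space p m). \<exists>\<sigma>\<in>words r. common_node m ys \<sigma>} \<ge>
    1 / (1 + (1 - p) ^ m / (2 * (1 - p) ^ m - 1))"
proof -
  interpret prob_space "tuple_space p m" by (rule prob_space_tuple_space)
  define \<theta> where "\<theta> = (1 - p) ^ m"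
  define C where "C = 1 + \<theta> / (2 * \<theta> - 1)"
  \<comment> \<open>The maximizer of the quadratic in \<open>second_moment_bound\<close>: the mean
    (2 \<theta>)^r divided by the bound C (2 \<theta>)^(2 r) on the second moment.\<close>
  define t where "t = 1 / (C * (2 * \<theta>) ^ r)"
  define A where "A \<sigma> = {ys \<in> space (tuple_space p m). common_node m ys \<sigma>}" for \<sigma>
  have \<theta>: "2 * \<theta> > 1" using assms by (simp add: \<theta>_def)
  then have C: "C > 0" by (simp add: C_def add_pos_pos)
  have A: "A \<sigma> \<in> events" for \<sigma> unfolding A_def by measurable
  have "(\<Sum>\<sigma>\<in>words r. prob (A \<sigma>)) = (\<Sum>\<sigma>\<in>words r. \<theta> ^ r)"
    by (intro sum.cong refl) (simp add: A_def measure_common_node \<theta>_def words_def)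
  then have first: "(\<Sum>\<sigma>\<in>words r. prob (A \<sigma>)) = (2 * \<theta>) ^ r"
    by (simp add: card_words power_mult_distrib)
  have "(\<Sum>\<sigma>\<in>words r. \<Sum>\<tau>\<in>words r. prob (A \<sigma> \<inter> A \<tau>)) \<le> pair_weight \<theta> r"
    unfolding pair_weight_def
  proof (intro sum_mono)
    fix \<sigma> \<tau>
    have "A \<sigma> \<inter> A \<tau> = {ys \<in> space (tuple_space p m). common_node m ys \<sigma> \<and> common_node m ys \<tau>}"
      by (auto simp: A_def)
    then show "prob (A \<sigma> \<inter> A \<tau>) \<le> \<theta> ^ card (edges \<sigma> \<union> edges \<tau>)"
      using measure_two_common_nodes_le[of m \<sigma> \<tau>] by (simp add: \<theta>_def)
  qed
  also have "\<dots> \<le> C * (2 * \<theta>) ^ (2 * r)"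
    unfolding C_def by (rule pair_weight_le[OF \<theta>])
  finally have second: "(\<Sum>\<sigma>\<in>words r. \<Sum>\<tau>\<in>words r. prob (A \<sigma> \<inter> A \<tau>)) \<le> C * (2 * \<theta>) ^ (2 * r)" .
  have "1 / C = 2 * t * (2 * \<theta>) ^ r - t\<^sup>2 * (C * (2 * \<theta>) ^ (2 * r))"
  proof -
    define D where "D = (2 * \<theta>) ^ r"
    have "D > 0" and D2: "(2 * \<theta>) ^ (2 * r) = D\<^sup>2" and "t = 1 / (C * D)"
      using \<theta> by (simp_all add: D_def t_def power_even_eq)
    then have tD: "t * D = 1 / C" using C by simp
    have "2 * t * D - t\<^sup>2 * (C * D\<^sup>2) = 2 * (t * D) - C * (t * D)\<^sup>2"
      by (simp add: power_mult_distrib)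
    also have "\<dots> = 1 / C" unfolding tD using C by (simp add: power2_eq_square)
    finally show ?thesis unfolding D2 unfolding D_def[symmetric] by simp
  qed
  also have "\<dots> \<le> 2 * t * (\<Sum>\<sigma>\<in>words r. prob (A \<sigma>)) -
      t\<^sup>2 * (\<Sum>\<sigma>\<in>words r. \<Sum>\<tau>\<in>words r. prob (A \<sigma> \<inter> A \<tau>))"
    unfolding first using second by (intro diff_left_mono mult_left_mono) auto
  also have "\<dots> \<le> prob (\<Union>\<sigma>\<in>words r. A \<sigma>)"
    by (rule second_moment_bound) (use A in auto)
  also have "(\<Union>\<sigma>\<in>words r. A \<sigma>) =
      {ys \<in> space (tuple_space p m). \<exists>\<sigma>\<in>words r. common_node m ys \<sigma>}" by (auto simp: A_def)
  finally show ?thesis by (simp add: C_def \<theta>_def)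
qed

text \<open>Trees are prefix closed, so the events of reaching level \<open>r\<close> decrease, and
  their uniform lower bound passes to the intersection.\<close>

lemma measure_all_levels_pos:
  assumes "2 * (1 - p) ^ m > 1"
  shows "measure (tuple_space p m)
      {ys \<in> space (tuple_space p m). \<forall>r. \<exists>\<sigma>\<in>words r. common_node m ys \<sigma>} > 0"
proof -
  interpret prob_space "tuple_space p m" by (rule prob_space_tuple_space)
  define G where "G r = {ys \<in> space (tuple_space p m). \<exists>\<sigma>\<in>words r. common_node m ys \<sigma>}" for r
  have sets: "range G \<subseteq> events" unfolding G_def by auto
  have "G (Suc r) \<subseteq> G r" for r
  proof
    fix ys assume "ys \<in> G (Suc r)"
    then obtain \<sigma> where \<sigma>: "ys \<in> space (tuple_space p m)" "length \<sigma> = Suc r" "common_node m ys \<sigma>"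
      by (auto simp: G_def words_def)
    then have "\<sigma> = butlast \<sigma> @ [last \<sigma>]" by (metis append_butlast_last_id length_0_conv nat.distinct(1))
    with \<sigma>(3) have "common_node m ys (butlast \<sigma>)"
      unfolding common_node_def by (metis tree_prefix)
    moreover have "butlast \<sigma> \<in> words r" using \<sigma>(2) by (simp add: words_def)
    ultimately show "ys \<in> G r" using \<sigma>(1) by (auto simp: G_def)
  qed
  then have "decseq G" by (simp add: decseq_Suc_iff)
  from finite_Lim_measure_decseq[OF sets this]
  have "(\<lambda>r. prob (G r)) \<longlonglongrightarrow> prob (\<Inter>r. G r)" .
  then have le: "1 / (1 + (1 - p) ^ m / (2 * (1 - p) ^ m - 1)) \<le> prob (\<Inter>r. G r)"
    using measure_common_level_ge[OF assms] by (intro LIMSEQ_le_const) (auto simp: G_def)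
  have "1 / (1 + (1 - p) ^ m / (2 * (1 - p) ^ m - 1)) > 0"
    using assms p_le_half by (intro divide_pos_pos add_pos_nonneg divide_nonneg_nonneg) auto
  from this le have "0 < prob (\<Inter>r. G r)" by (rule less_le_trans)
  also have "(\<Inter>r. G r) = {ys \<in> space (tuple_space p m). \<forall>r. \<exists>\<sigma>\<in>words r. common_node m ys \<sigma>}"
    by (auto simp: G_def)
  finally show ?thesis .
qed

end

section \<open>Koenig's lemma and the closed sets given by codes\<close>

lemma prefix_closed_append:
  assumes "\<And>\<sigma> b. \<sigma> @ [b] \<in> T \<Longrightarrow> \<sigma> \<in> T" "\<sigma> @ \<tau> \<in> T"
  shows "\<sigma> \<in> T"
  using assms(2)
proof (induction \<tau> rule: rev_induct)
  case (snoc b \<tau>)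
  then show ?case using assms(1)[of "\<sigma> @ \<tau>" b] by simp
qed simp

text \<open>Koenig's lemma for binary trees. A word is good if it has extensions in \<open>T\<close>
  of every length; some child of a good word is good, and following good children yields a
  path.\<close>

lemma infinite_tree_has_path:
  assumes prefix: "\<And>\<sigma> b. \<sigma> @ [b] \<in> T \<Longrightarrow> \<sigma> \<in> T" and levels: "\<And>r. \<exists>\<sigma>\<in>words r. \<sigma> \<in> T"
  shows "paths T \<noteq> {}"
proof -
  define good where "good \<sigma> \<longleftrightarrow> (\<forall>r. \<exists>\<tau>\<in>words r. \<sigma> @ \<tau> \<in> T)" for \<sigma>
  have step: "\<exists>b. good (\<sigma> @ [b])" if \<sigma>: "good \<sigma>" for \<sigma>
  proof (rule ccontr)
    assume "\<not> ?thesis"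
    then obtain f where f: "\<And>b \<tau>. \<tau> \<in> words (f b) \<Longrightarrow> (\<sigma> @ [b]) @ \<tau> \<notin> T"
      unfolding good_def by metis
    \<comment> \<open>One letter to enter a child, then the larger of the two depths at which the
      children are assumed to die out.\<close>
    obtain \<tau> where \<tau>: "length \<tau> = Suc (max (f True) (f False))" "\<sigma> @ \<tau> \<in> T"
      using \<sigma> unfolding good_def words_def by blast
    then obtain b \<tau>' where b: "\<tau> = b # \<tau>'" "length \<tau>' = max (f True) (f False)"
      by (cases \<tau>) auto
    have "f b \<le> length \<tau>'" unfolding b(2) by (cases b) auto
    then have "take (f b) \<tau>' \<in> words (f b)" by (simp add: words_def)
    moreover have "((\<sigma> @ [b]) @ take (f b) \<tau>') @ drop (f b) \<tau>' \<in> T" using \<tau>(2) b(1) by simp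
    then have "(\<sigma> @ [b]) @ take (f b) \<tau>' \<in> T" by (rule prefix_closed_append[rotated]) (rule prefix)
    ultimately show False using f by blast
  qed
  define ext where "ext = rec_nat [] (\<lambda>_ \<tau>. \<tau> @ [SOME b. good (\<tau> @ [b])])"
  define z where "z r = (SOME b. good (ext r @ [b]))" for r
  have ext: "initial z r = ext r" for r
    by (induction r) (simp_all add: initial_Suc z_def, simp_all add: ext_def)
  have "good (ext r)" for r
  proof (induction r)
    case 0
    show ?case using levels by (simp add: good_def ext_def)
  next
    case (Suc r)
    have "good (ext r @ [z r])" unfolding z_def by (rule someI_ex[OF step[OF Suc]])
    then show ?case using ext[of "Suc r"] ext[of r] by (simp add: initial_Suc)
  qed
  then have "initial z r @ [] \<in> T" for r
    unfolding ext good_def words_def by (metis (mono_tags) length_0_conv mem_Collect_eq)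
  then show ?thesis unfolding paths_def by auto
qed

lemma closed_initial_in: "closed {z::nat \<Rightarrow> bool. initial z r \<in> S}"
proof (induction r arbitrary: S)
  case (Suc r)
  have coord: "closed {z::nat \<Rightarrow> bool. z r = b}" for b
  proof -
    have "closed ((\<lambda>z::nat \<Rightarrow> bool. z r) -` {b})"
      by (intro closed_vimage continuous_on_product_coordinates) simp
    then show ?thesis by (simp add: vimage_def)
  qed
  have "{z. initial z (Suc r) \<in> S} =
      ({z. z r = True} \<inter> {z. initial z r \<in> {w. w @ [True] \<in> S}}) \<union>
      ({z. z r = False} \<inter> {z. initial z r \<in> {w. w @ [False] \<in> S}})"
  proof -
    have "initial z (Suc r) \<in> S \<longleftrightarrow> z r = True \<and> initial z r @ [True] \<in> S \<or>
        z r = False \<and> initial z r @ [False] \<in> S" for z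
      by (cases "z r") (simp_all add: initial_Suc)
    then show ?thesis by blast
  qed
  also have "closed \<dots>" by (intro closed_Un closed_Int coord Suc)
  finally show ?case .
qed simp

lemma paths_tree_in_closed_sets: "paths (tree x) \<in> closed_sets"
proof -
  have "paths (tree x) = (\<Inter>r. {z. initial z r \<in> tree x})" by (auto simp: paths_def)
  then have "closed (paths (tree x))" by (simp add: closed_INT closed_initial_in)
  moreover have "\<exists>\<sigma>\<in>words r. \<sigma> \<in> tree x" for r
  proof (induction r)
    case 0
    show ?case by (simp add: words_0 tree_iff)
  next
    case (Suc r)
    then obtain \<sigma> b where "length \<sigma> = r" "\<sigma> @ [b] \<in> tree x"
      unfolding words_def using tree_extend by blast
    then show ?case by (intro bexI[of _ "\<sigma> @ [b]"]) (auto simp: words_def)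
  qed
  then have "paths (tree x) \<noteq> {}" by (rule infinite_tree_has_path[rotated]) (rule tree_prefix)
  ultimately show ?thesis by (simp add: closed_sets_def)
qed

lemma code_of_paths_tree: "ternary x \<Longrightarrow> code_of (paths (tree x)) = x"
  using code_works[OF paths_tree_in_closed_sets] by (intro code_unique) auto

lemma measurable_join:
  assumes "set js \<subseteq> {..<m}"
  shows "(\<lambda>ys. join (map ys js)) \<in> measurable (tuple_space p m) seq_space"
proof (cases "js = []")
  case True
  then show ?thesis by (simp add: join_def space_PiM)
next
  case False
  have "(\<lambda>ys. ys j i) \<in> measurable (tuple_space p m) (count_space UNIV)" if "j < m" for j i
    using measurable_compose[OF measurable_tuple_component[OF that] measurable_component_singleton[of i]]
    by simp
  moreover have "js ! (i mod length js) < m" for i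
  proof -
    have "js ! (i mod length js) \<in> set js" using False by (intro nth_mem) simp
    then show ?thesis using assms by blast
  qed
  ultimately have "(\<lambda>ys. join (map ys js) i) \<in> measurable (tuple_space p m) (count_space UNIV)" for i
    using False by (simp add: join_def)
  then show ?thesis by (intro measurable_PiM_single') (auto simp: space_PiM)
qed

theorem (in bernoulli_tree) intersecting_mutually_random:
  assumes "2 * (1 - p) ^ m > 1"
  shows "\<exists>Ps. length Ps = m \<and> mutually_random_closed p Ps \<and> \<Inter> (set Ps) \<noteq> {}"
proof -
  let ?M = "tuple_space p m"
  interpret M: prob_space ?M by (rule prob_space_tuple_space)
  \<comment> \<open>The indices other than \<open>i\<close>, in the order in which
    \<open>mutually_random_closed\<close> joins the remaining codes.\<close>
  define others where "others i = take i [0..<m] @ drop (Suc i) [0..<m]" for i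
  have set_others: "set (others i) \<subseteq> {..<m}" for i
    using set_take_subset[of i "[0..<m]"] set_drop_subset[of "Suc i" "[0..<m]"]
    by (auto simp: others_def)
  have not_in: "i \<notin> set (others i)" if "i < m" for i
    using that by (auto simp: others_def take_upt drop_upt)
  have "AE ys in ?M. martin_loef_random p (join (map ys (others i))) (ys i)" if "i < m" for i
    by (rule AE_random_rel) (use that p_nonneg p_le_half not_in in
        \<open>auto intro!: measurable_join set_others simp: map_fun_upd\<close>)
  then have "AE ys in ?M. \<forall>i\<in>{..<m}. martin_loef_random p (join (map ys (others i))) (ys i)"
    by (intro AE_finite_allI) auto
  then obtain ys where ys: "\<And>i. i < m \<Longrightarrow> martin_loef_random p (join (map ys (others i))) (ys i)"
    and levels: "\<And>r. \<exists>\<sigma>\<in>words r. common_node m ys \<sigma>"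
  proof (atomize_elim, rule_tac ccontr)
    let ?G = "{ys \<in> space ?M. \<forall>r. \<exists>\<sigma>\<in>words r. common_node m ys \<sigma>}"
    assume AE: "AE ys in ?M. \<forall>i\<in>{..<m}. martin_loef_random p (join (map ys (others i))) (ys i)"
      and none: "\<nexists>ys. (\<forall>i<m. martin_loef_random p (join (map ys (others i))) (ys i)) \<and>
        (\<forall>r. \<exists>\<sigma>\<in>words r. common_node m ys \<sigma>)"
    \<comment> \<open>If no tuple had both properties, the survival event would be null, contrary to
      its positive measure.\<close>
    from AE have "AE ys in ?M. ys \<notin> ?G"
      by eventually_elim (use none in auto)
    moreover have "?G \<in> M.events" by measurable
    ultimately have "M.prob ?G = 0" by (simp add: M.prob_eq_0)
    with measure_all_levels_pos[OF assms] show False by simp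
  qed
  define Ps where "Ps = map (\<lambda>j. paths (tree (ys j))) [0..<m]"
  have code: "code_of (paths (tree (ys j))) = ys j" if "j < m" for j
    using ys[OF that] by (intro code_of_paths_tree) (simp add: martin_loef_random_def)
  have "mutually_random_closed p Ps"
    unfolding mutually_random_closed_def
  proof (intro conjI allI impI)
    show "set Ps \<subseteq> closed_sets" using paths_tree_in_closed_sets by (auto simp: Ps_def)
    fix i assume i: "i < length Ps"
    have "map code_of (take i Ps @ drop (Suc i) Ps) = map (\<lambda>j. code_of (paths (tree (ys j)))) (others i)"
      by (simp add: Ps_def others_def take_map drop_map)
    also have "\<dots> = map ys (others i)"
      using code set_others by (intro map_cong) auto
    finally show "martin_loef_random p (join (map code_of (take i Ps @ drop (Suc i) Ps)))
        (code_of (Ps ! i))"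
      using i ys[of i] code[of i] by (simp add: Ps_def)
  qed
  moreover have "\<Inter> (set Ps) \<noteq> {}"
  proof -
    \<comment> \<open>Survival at every level provides only finite words. The common nodes form a
      prefix closed set themselves, so Koenig's lemma supplies a point common to all the closed
      sets.\<close>
    have "paths {\<sigma>. common_node m ys \<sigma>} \<noteq> {}"
    proof (rule infinite_tree_has_path)
      show "\<exists>\<sigma>\<in>words r. \<sigma> \<in> {\<sigma>. common_node m ys \<sigma>}" for r using levels by simp
      show "\<sigma> \<in> {\<sigma>. common_node m ys \<sigma>}" if "\<sigma> @ [b] \<in> {\<sigma>. common_node m ys \<sigma>}" for \<sigma> b
        using that tree_prefix unfolding common_node_def by blast
    qed
    then obtain z where "\<And>r. common_node m ys (initial z r)" by (auto simp: paths_def)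
    then have "z \<in> \<Inter> (set Ps)" by (auto simp: Ps_def paths_def common_node_def)
    then show ?thesis by blast
  qed
  moreover have "length Ps = m" by (simp add: Ps_def)
  ultimately show ?thesis by blast
qed

section \<open>Members of random closed sets have large dimension\<close>

lemma card_short_words: "card {\<rho> :: bool list. length \<rho> \<le> k} \<le> 2 * 2 ^ k"
proof -
  have "card {\<rho> :: bool list. length \<rho> \<le> k} = (\<Sum>i\<le>k. 2 ^ i)"
    using card_lists_length_le[of "UNIV :: bool set" k] by simp
  also have "\<dots> \<le> 2 * 2 ^ k" by (induction k) auto
  finally show ?thesis .
qed

lemma finite_short_words: "finite {\<rho> :: bool list. length \<rho> \<le> k}"
  using finite_lists_length_le[of "UNIV :: bool set" k] by simp

context bernoulli_tree
begin

text \<open>A union bound over programs: at most 2 * 2^k of them have length up to \<open>k\<close>,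
  the integer part of a r / b, and each names a single word, which lies in the tree with probability
  (1 - p)^r.\<close>

lemma measure_compressible_level_le:
  fixes U :: "bool list \<Rightarrow> bool list option"
  assumes "b > 0"
  shows "measure (bernoulli3 p)
      {x. \<exists>\<rho> \<sigma>. U \<rho> = Some \<sigma> \<and> length \<sigma> = r \<and> b * length \<rho> < a * r \<and> \<sigma> \<in> tree x}
    \<le> 2 * (2 powr (real a / real b) * (1 - p)) ^ r" (is "measure _ ?E \<le> _")
proof -
  interpret prob_space "bernoulli3 p" by (rule prob_space_bernoulli3)
  define k where "k = a * r div b"
  define R where "R = {\<rho>. b * length \<rho> < a * r \<and> (\<exists>\<sigma>. U \<rho> = Some \<sigma> \<and> length \<sigma> = r)}"
  have R: "R \<subseteq> {\<rho>. length \<rho> \<le> k}"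
    using assms by (auto simp: R_def k_def less_eq_div_iff_mult_less_eq mult.commute)
  then have fin: "finite R" by (rule finite_subset) (rule finite_short_words)
  have "?E = (\<Union>\<rho>\<in>R. {x. the (U \<rho>) \<in> tree x})"
    unfolding R_def by force
  then have "measure (bernoulli3 p) ?E \<le> (\<Sum>\<rho>\<in>R. measure (bernoulli3 p) {x. the (U \<rho>) \<in> tree x})"
    using fin by (auto intro!: finite_measure_subadditive_finite Collect_in_sets_bernoulli3)
  also have "\<dots> = (\<Sum>\<rho>\<in>R. (1 - p) ^ r)"
    by (intro sum.cong refl) (auto simp: measure_in_tree R_def)
  also have "\<dots> = real (card R) * (1 - p) ^ r" by simp
  also have "\<dots> \<le> (2 * 2 powr (real a / real b * real r)) * (1 - p) ^ r"
  proof (rule mult_right_mono)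
    have "card R \<le> 2 * 2 ^ k"
      using card_mono[OF finite_short_words R] card_short_words[of k] by linarith
    then have "real (card R) \<le> real (2 * 2 ^ k)" by (rule of_nat_mono)
    then have "real (card R) \<le> 2 * 2 powr real k" by (simp add: powr_realpow)
    also have "real k \<le> real a / real b * real r"
      using of_nat_div_le_of_nat[of "a * r" b, where 'a = real] by (simp add: k_def)
    then have "2 * 2 powr real k \<le> 2 * 2 powr (real a / real b * real r)" by simp
    finally show "real (card R) \<le> 2 * 2 powr (real a / real b * real r)" .
  qed (use p_le_half in simp)
  also have "\<dots> = 2 * (2 powr (real a / real b) * (1 - p)) ^ r"
    unfolding power_mult_distrib powr_powr[symmetric] by (subst powr_realpow) simp_all
  finally show ?thesis .
qed

text \<open>Component \<open>m\<close> collects all lengths from c (m + 1) on, so its measure is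
  bounded by the tail of a geometric series.\<close>

lemma compressible_test_is_test:
  fixes U :: "bool list \<Rightarrow> bool list option"
  assumes U: "partial_computable_machine U" and b: "b > 0"
    and less: "2 powr (real a / real b) * (1 - p) < 1"
  shows "\<exists>c\<ge>1. martin_loef_test p no_oracle (compressible_test U a b c)"
proof -
  interpret prob_space "bernoulli3 p" by (rule prob_space_bernoulli3)
  define \<theta> where "\<theta> = 2 powr (real a / real b) * (1 - p)"
  have \<theta>: "0 \<le> \<theta>" "\<theta> < 1" using less p_le_half by (simp_all add: \<theta>_def)
  have "(\<lambda>c. \<theta> ^ c) \<longlonglongrightarrow> 0" using \<theta> by (intro LIMSEQ_power_zero) simp
  \<comment> \<open>The tail is (\<theta>^c)^m * (2 \<theta>^c / (1 - \<theta>)). This choice makes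
    the second factor at most 1, and also \<theta>^c \<le> 1/2, so the first is at most
    (1/2)^m.\<close>
  then have "\<forall>\<^sub>F c in sequentially. \<theta> ^ c < (1 - \<theta>) / 2"
    using \<theta> by (intro order_tendstoD(2)) auto
  moreover have "\<forall>\<^sub>F c in sequentially. c \<ge> (1::nat)" by (rule eventually_ge_at_top)
  ultimately have "\<forall>\<^sub>F c in sequentially. \<theta> ^ c < (1 - \<theta>) / 2 \<and> c \<ge> 1"
    by (rule eventually_conj)
  then obtain c where c: "\<theta> ^ c < (1 - \<theta>) / 2" "c \<ge> 1"
    using eventually_happens'[OF sequentially_bot] by blast
  have "measure (bernoulli3 p) (cylinders (compressible_test U a b c m)) \<le> (1/2) ^ m" for m
  proof -
    define E where "E r = {x. \<exists>\<rho> \<sigma>. U \<rho> = Some \<sigma> \<and> length \<sigma> = r \<and> b * length \<rho> < a * r \<and>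
      \<sigma> \<in> tree x}" for r
    have E: "E r \<in> events" for r
      unfolding E_def by (intro Collect_in_sets_bernoulli3) measurable
    define B where "B i = 2 * \<theta> ^ (c * Suc m) * \<theta> ^ i" for i
    have E_le: "prob (E (c * Suc m + i)) \<le> B i" for i
      using measure_compressible_level_le[OF b, of U "c * Suc m + i" a]
      by (simp add: E_def B_def \<theta>_def power_add mult.assoc)
    have B: "B sums (2 * \<theta> ^ (c * Suc m) * (1 / (1 - \<theta>)))"
      unfolding B_def using \<theta> by (intro sums_mult geometric_sums) simp
    have summable: "summable (\<lambda>i. prob (E (c * Suc m + i)))"
      by (rule summable_comparison_test'[OF sums_summable[OF B], of 0]) (use E_le in simp)
    have "cylinders (compressible_test U a b c m) = (\<Union>i. E (c * Suc m + i))"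
    proof (intro set_eqI iffI)
      fix x assume "x \<in> cylinders (compressible_test U a b c m)"
      then obtain \<rho> \<sigma> where *: "U \<rho> = Some \<sigma>" "c * Suc m \<le> length \<sigma>"
        "b * length \<rho> < a * length \<sigma>" "\<sigma> \<in> tree x"
        unfolding in_cylinders_compressible_test_iff by blast
      then have "x \<in> E (c * Suc m + (length \<sigma> - c * Suc m))"
        unfolding E_def le_add_diff_inverse[OF *(2)] by blast
      then show "x \<in> (\<Union>i. E (c * Suc m + i))" by blast
    next
      fix x assume "x \<in> (\<Union>i. E (c * Suc m + i))"
      then obtain i \<rho> \<sigma> where "U \<rho> = Some \<sigma>" "length \<sigma> = c * Suc m + i"
        "b * length \<rho> < a * length \<sigma>" "\<sigma> \<in> tree x"
        unfolding E_def by auto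
      moreover from this(2) have "c * Suc m \<le> length \<sigma>" by linarith
      ultimately show "x \<in> cylinders (compressible_test U a b c m)"
        unfolding in_cylinders_compressible_test_iff by blast
    qed
    then have "prob (cylinders (compressible_test U a b c m)) \<le> (\<Sum>i. prob (E (c * Suc m + i)))"
      using E summable by (auto intro!: finite_measure_subadditive_countably)
    also have "\<dots> \<le> (\<Sum>i. B i)" by (intro suminf_le E_le summable sums_summable[OF B])
    also have "\<dots> = (\<theta> ^ c) ^ m * (2 * \<theta> ^ c / (1 - \<theta>))"
      unfolding sums_unique[OF B, symmetric] by (simp add: power_add flip: power_mult)
    also have "\<dots> \<le> (1/2) ^ m * 1"
      using c \<theta> by (intro mult_mono power_mono) (auto simp: field_simps)
    finally show ?thesis by simp
  qed
  then show ?thesis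
    unfolding martin_loef_test_def using c(2) uniformly_ce_compressible_test[OF U] by blast
qed

lemma dim_of_member_lower_bound:
  assumes U: "optimal_machine U" and C: "random_closed p C" "x \<in> C"
    and dim: "effective_dim U x = ereal (1 / real n)" and n: "n \<ge> 1"
  shows "1 / 2 \<le> (1 - p) ^ n"
proof (rule ccontr)
  assume "\<not> ?thesis"
  then have q: "(1 - p) ^ n < 1 / 2" "0 < 1 - p" using p_le_half by auto
  have "ln ((1 - p) ^ n) < ln (1 / 2)" using q by (subst ln_less_cancel_iff) auto
  then have "real n * ln (1 - p) < - ln 2" using q by (simp add: ln_realpow ln_div)
  then have "1 / real n < - ln (1 - p) / ln 2" using n by (simp add: field_simps)
  \<comment> \<open>The upper limit is the negative binary logarithm of 1 - p, so t below it means
    2^t (1 - p) < 1. A rational t makes the comparison of program length with word length one of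
    natural numbers.\<close>
  then obtain t where t: "t \<in> \<rat>" "1 / real n < t" "t < - ln (1 - p) / ln 2"
    using Rats_dense_in_real by blast
  then have "t > 0" using n by (meson divide_nonneg_nonneg le_less_trans of_nat_0_le_iff zero_le_one)
  then obtain a b :: nat where ab: "b > 0" "t = real a / real b"
    using Rats_abs_nat_div_natE[OF t(1)] by (metis abs_of_pos gr0I)
  have "2 powr t * (1 - p) = exp (t * ln 2 + ln (1 - p))"
    using q by (simp add: powr_def exp_add)
  also have "t * ln 2 + ln (1 - p) < 0" using t(3) by (simp add: field_simps)
  then have "exp (t * ln 2 + ln (1 - p)) < 1" by simp
  finally have less: "2 powr (real a / real b) * (1 - p) < 1" unfolding ab(2) .
  have pcU: "partial_computable_machine U" using U by (simp add: optimal_machine_def)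
  obtain c where c: "c \<ge> 1" "martin_loef_test p no_oracle (compressible_test U a b c)"
    using compressible_test_is_test[OF pcU ab(1) less] by blast
  \<comment> \<open>The least length in \<open>complexity\<close> is attained only if some program
    exists; simulating the identity machine provides one for every word.\<close>
  have ex_program: "\<exists>\<rho>. length \<rho> = complexity U \<sigma> \<and> U \<rho> = Some \<sigma>" for \<sigma>
  proof -
    have "computes no_oracle (Proj 0) [y] z \<longleftrightarrow> z = y" for y z
      using computes.proj[of 0 "[y]" no_oracle] by (auto elim: computes_ProjE)
    then have "partial_computable_machine Some"
      unfolding partial_computable_machine_def by (intro exI[of _ "Proj 0"]) auto
    then obtain \<rho> where "U \<rho> = Some \<sigma>"
      using U unfolding optimal_machine_def by blast
    then have "\<exists>l \<rho>. length \<rho> = l \<and> U \<rho> = Some \<sigma>" by blast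
    then show ?thesis unfolding complexity_def by (rule LeastI_ex)
  qed
  have "code_of C \<in> cylinders (compressible_test U a b c m)" for m
  proof -
    have "\<exists>r\<ge>c * Suc m. real (complexity U (initial x r)) / real r < t"
    proof (rule ccontr)
      assume "\<not> ?thesis"
      then have "ereal t \<le> effective_dim U x"
        unfolding effective_dim_def
        by (intro Liminf_bounded eventually_sequentiallyI[of "c * Suc m"]) (auto simp: not_less)
      with dim t(2) show False by simp
    qed
    then obtain r where r: "c * Suc m \<le> r" "real (complexity U (initial x r)) / real r < t"
      by blast
    \<comment> \<open>At length 0 the quotient is 0 by the convention for division and would say
      nothing about compression; \<open>c \<ge> 1\<close> excludes this case.\<close>
    have "1 * 1 \<le> c * Suc m" using c(1) by (intro mult_mono) auto
    then have "r > 0" using r(1) by simp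
    obtain \<rho> where \<rho>: "length \<rho> = complexity U (initial x r)" "U \<rho> = Some (initial x r)"
      using ex_program by blast
    have "real b * real (length \<rho>) < real a * real r"
      using r(2) \<open>r > 0\<close> ab by (simp add: \<rho>(1) field_simps)
    then have "b * length \<rho> < a * r" by (simp flip: of_nat_mult)
    moreover have "initial x r \<in> tree (code_of C)"
      using C code_works(2)[of C] by (auto simp: random_closed_def paths_def)
    ultimately show ?thesis
      unfolding in_cylinders_compressible_test_iff
      using \<rho>(2) r(1) by (intro exI[of _ \<rho>] exI[of _ "initial x r"]) simp
  qed
  moreover have "martin_loef_random p no_oracle (code_of C)"
    using C(1) by (simp add: random_closed_def)
  ultimately show False
    using c(2) unfolding martin_loef_random_def by blast
qed

end

theorem theorem21:
  fixes U :: "bool list \<Rightarrow> bool list option" and n :: nat and x :: "nat \<Rightarrow> bool" and s :: real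
  assumes "optimal_machine U"
    and "n \<ge> 2"
    and "effective_dim U x = ereal s"
    and "s = 1 / real n"
  shows "\<forall>k::int. k < \<lfloor>1 / s\<rfloor> - 1 \<longrightarrow>
    \<not> (\<exists>p. computable_real p \<and> p \<in> {0..1/2} \<and>
          (\<exists>d. int d = k \<and> degree_of_intersectability p d) \<and>
          (\<exists>C. random_closed p C \<and> x \<in> C))"
proof (intro allI impI notI)
  fix k :: int
  assume k: "k < \<lfloor>1 / s\<rfloor> - 1"
    and "\<exists>p. computable_real p \<and> p \<in> {0..1/2} \<and>
      (\<exists>d. int d = k \<and> degree_of_intersectability p d) \<and> (\<exists>C. random_closed p C \<and> x \<in> C)"
  then obtain p d C where p: "0 \<le> p" "p \<le> 1/2" and d: "int d = k" "degree_of_intersectability p d"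
    and C: "random_closed p C" "x \<in> C" by auto
  interpret bernoulli_tree p by unfold_locales (use p in auto)
  \<comment> \<open>Here 1 / s equals n, so the floor is n itself.\<close>
  have "d + 1 < n" using k d(1) assms(4) by simp
  have half: "1 / 2 \<le> (1 - p) ^ n"
    using dim_of_member_lower_bound[OF assms(1) C] assms(2-4) by simp
  \<comment> \<open>Powers of 1 - p decrease strictly only for p > 0; for p = 0 the power is
    1.\<close>
  have "1 / 2 < (1 - p) ^ (d + 1)"
  proof (cases "p = 0")
    case False
    then have "(1 - p) ^ n < (1 - p) ^ (d + 1)"
      using p \<open>d + 1 < n\<close> by (intro power_strict_decreasing) auto
    with half show ?thesis by simp
  qed simp
  then obtain Ps where "length Ps = d + 1" "mutually_random_closed p Ps" "\<Inter> (set Ps) \<noteq> {}"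
    using intersecting_mutually_random[of "d + 1"] by auto
  with d(2) show False unfolding degree_of_intersectability_def by blast
qed

end
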